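(* The process $Y_{n}:= Y+ \overline{Z}_{n-1}^{\delta,r}$ is $\mathfrak{F}$-adapted, right-continuous and satisfies $$Z_{n}^{\delta,\mathfrak{F}}(\sigma)_{\mathrm{disc}}= \operatorname*{ess\,sup}_{\tau\in \mathcal{S}_\sigma}\; \mathbb{E}(Y_{n}(\tau)\,|\,\mathcal{F}_\sigma)$$ (almost surely) for all $\mathfrak{F}$-stopping times $\sigma$. If $\delta_1,\dots,\delta_{n-1}$ are $\mathfrak{F}$-stopping times, then furthermore $$Z_{n}^{\delta,\mathfrak{F}}(\sigma)= \operatorname*{ess\,sup}_{\tau\in \mathcal{S}_\sigma}\; \mathbb{E}(Y_{n}(\tau)\,|\,\mathcal{F}_\sigma)$$ (almost surely) for all $\mathfrak{F}$-stopping times $\sigma$.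
   Context: $(\Omega,\mathcal{F},\mathbb{P})$ is a probability space with a filtration $\mathfrak{F}=(\mathcal{F}_t)_{t\ge 0}$ satisfying the usual conditions (right-continuous, $\mathcal{F}_0$ contains all $\mathbb{P}$-null sets); $\mathcal{F}_\infty=\sigma(\bigcup_{t\ge0}\mathcal{F}_t)$. Stopping times take values in $[0,\infty]$. $Y=(Y(t))_{t\ge0}$ is an $\mathfrak{F}$-adapted, non-negative, right-continuous process with $\mathbb{E}(\sup_{t\ge0}Y(t))<\infty$, and $Y(+\infty):=\limsup_{t\to\infty}Y(t)$. $n\ge 1$ is a fixed integer; $\delta=(\delta_1,\dots,\delta_{n-1})$ are non-negative, a.s. finite random variables (not necessarily related to $\mathfrak{F}$), and $L\delta:=(\delta_2,\dots,\delta_{n-1})$. Enlarged filtrations: for a filtration $\mathfrak{A}=(\mathcal{A}_t)_{t\ge0}$ and $\rho:\Omega\to[0,\infty]$, $\mathfrak{A}^\rho=(\mathcal{A}^\rho_t)_{t\ge0}$ is the smallest right-continuous filtration containing $\mathfrak{A}$ for which $\rho$ is a stopping time, i.e. the right-continuous filtration generated by $\bigl(\sigma(\mathcal{A}_t\cup\{\{\rho\le s\}: s\le t\})\bigr)_{t\ge0}$. Recursively $\mathfrak{A}^{\rho_1,\dots,\rho_i}=(\mathfrak{A}^{\rho_1,\dots,\rho_{i-1}})^{\rho_i}$. Strategies: for $\mathfrak{A}$ equal to $\mathfrak{F}$ or such an enlargement of it, $m\ge1$, waiting times $\gamma=(\gamma_1,\dots,\gamma_{m-1})$ and an $\mathfrak{A}$-stopping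 time $\sigma$, $\mathcal{S}^m_\sigma(\gamma,\mathfrak{A})$ is the set of all $(\tau_1,\dots,\tau_m)$ such that $\tau_1$ is an $\mathfrak{A}$-stopping time with $\sigma\le\tau_1$ and, for $i=2,\dots,m$, $\tau_i$ is an $\mathfrak{A}^{\tau_1+\gamma_1,\dots,\tau_{i-1}+\gamma_{i-1}}$-stopping time with $\tau_{i-1}+\gamma_{i-1}\le\tau_i$. $\mathcal{S}^m_\sigma(\gamma,\mathfrak{A})_{\mathrm{disc}}$ is the subset of those with $\tau_1$ of countable range. $\mathcal{S}_\sigma$ is the set of $\mathfrak{F}$-stopping times $\tau\ge\sigma$. Values: $Z_m^{\gamma,\mathfrak{A}}(\sigma):=\operatorname*{ess\,sup}_{\tau\in\mathcal{S}^m_\sigma(\gamma,\mathfrak{A})}\mathbb{E}\bigl(\sum_{i=1}^mY(\tau_i)\,|\,\mathcal{A}_\sigma\bigr)$, and $Z_m^{\gamma,\mathfrak{A}}(\sigma)_{\mathrm{disc}}$ is defined in the same way with $\mathcal{S}^m_\sigma(\gamma,\mathfrak{A})_{\mathrm{disc}}$. $Z_0\equiv0$ (so for $n=1$ the process below is $0$). The process $\overline{Z}_{n-1}^{\delta}(t):=\mathbb{E}\bigl(Z_{n-1}^{L\delta,\mathfrak{F}^{t+\delta_1}}(t+\delta_1)\,|\,\mathcal{F}_t\bigr)$ is an $\mathfrak{F}$-supermartingale having a right-continuous modification, and $\overline{Z}_{n-1}^{\delta,r}$ denotes such a right-continuous modification. At $t=+\infty$ one uses the same formula, i.e. $\overline{Z}_{n-1}^{\delta,r}(+\infty)=\overline{Z}_{n-1}^{\delta}(+\infty)=(n-1)Y(+\infty)$.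 *)

theory Defs
  imports "HOL-Probability.Probability"
begin

text \<open>
  Time is the interval \<open>[0,\<infinity>]\<close>, i.e. the type \<^typ>\<open>ennreal\<close>. A filtration indexed by
  \<open>[0,\<infinity>)\<close> is represented together with its terminal sigma-algebra at index \<open>\<infinity>\<close>. With this
  encoding the library's \<^const>\<open>stopping_time\<close> is the notion of a \<open>[0,\<infinity>]\<close>-valued stopping time
  (the condition at index \<open>\<infinity>\<close> is vacuous), and \<^const>\<open>filtration.pre_sigma\<close> is the usual
  sigma-algebra of the events \<open>A\<close> in the terminal sigma-algebra such that
  \<open>A \<inter> {T \<le> t}\<close> is known at time \<open>t\<close>, for all finite \<open>t\<close>.
\<close>

locale usual_filtration = prob_space M + filtration "space M" F
  for M :: "'a measure" and F :: "ennreal \<Rightarrow> 'a measure" +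
  assumes subalgebra_F: "\<And>t. subalgebra M (F t)"
    and sets_F_infinity: "sets (F \<infinity>) = sigma_sets (space M) (\<Union>t\<in>{..<\<infinity>}. sets (F t))"
    and right_continuous_F: "\<And>t. t < \<infinity> \<Longrightarrow> sets (F t) = (\<Inter>s\<in>{t<..<\<infinity>}. sets (F s))"
    and null_sets_F: "null_sets M \<subseteq> sets (F 0)"

definition adapted :: "(ennreal \<Rightarrow> 'a measure) \<Rightarrow> (ennreal \<Rightarrow> 'a \<Rightarrow> ennreal) \<Rightarrow> bool" where
  "adapted F X \<longleftrightarrow> (\<forall>t<\<infinity>. X t \<in> borel_measurable (F t))"

definition right_continuous_paths :: "'a measure \<Rightarrow> (ennreal \<Rightarrow> 'a \<Rightarrow> ennreal) \<Rightarrow> bool" where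
  "right_continuous_paths M X \<longleftrightarrow>
     (\<forall>\<omega>\<in>space M. \<forall>t<\<infinity>. continuous (at_right t) (\<lambda>s. X s \<omega>))"

subsection \<open>Essential suprema of families of random variables\<close>

text \<open>
  The library's \<^const>\<open>esssup\<close> is the essential supremum of a single function, a constant. The
  essential supremum of a family is only determined up to null sets; for measurable families over a
  probability space it exists, and all statements below hold almost surely, so it does not matter
  which version is chosen.
\<close>

definition is_family_esssup :: "'a measure \<Rightarrow> ('a \<Rightarrow> ennreal) set \<Rightarrow> ('a \<Rightarrow> ennreal) \<Rightarrow> bool" where
  "is_family_esssup M \<Phi> Z \<longleftrightarrow>
     Z \<in> borel_measurable M \<and>
     (\<forall>X\<in>\<Phi>. AE \<omega> in M. X \<omega> \<le> Z \<omega>) \<and>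
     (\<forall>W\<in>borel_measurable M. (\<forall>X\<in>\<Phi>. AE \<omega> in M. X \<omega> \<le> W \<omega>) \<longrightarrow> (AE \<omega> in M. Z \<omega> \<le> W \<omega>))"

definition family_esssup :: "'a measure \<Rightarrow> ('a \<Rightarrow> ennreal) set \<Rightarrow> 'a \<Rightarrow> ennreal" where
  "family_esssup M \<Phi> = (SOME Z. is_family_esssup M \<Phi> Z)"

subsection \<open>Enlarged filtrations\<close>

definition adjoin_time ::
  "'a measure \<Rightarrow> (ennreal \<Rightarrow> 'a measure) \<Rightarrow> ('a \<Rightarrow> ennreal) \<Rightarrow> ennreal \<Rightarrow> 'a measure" where
  "adjoin_time M A \<rho> t =
     sigma (space M) (sets (A t) \<union> {{\<omega>\<in>space M. \<rho> \<omega> \<le> s} | s. s \<le> t})"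

definition enlarge ::
  "'a measure \<Rightarrow> (ennreal \<Rightarrow> 'a measure) \<Rightarrow> ('a \<Rightarrow> ennreal) \<Rightarrow> ennreal \<Rightarrow> 'a measure" where
  "enlarge M A \<rho> t =
     sigma (space M)
       (if t < \<infinity> then (\<Inter>s\<in>{t<..<\<infinity>}. sets (adjoin_time M A \<rho> s))
        else (\<Union>s\<in>{..<\<infinity>}. sets (adjoin_time M A \<rho> s)))"

text \<open>All finite sequences are indexed from 1, so \<open>enlarge_seq M A \<rho> i\<close> adjoins \<open>\<rho> 1, \<dots>, \<rho> i\<close>.\<close>

primrec enlarge_seq ::
  "'a measure \<Rightarrow> (ennreal \<Rightarrow> 'a measure) \<Rightarrow> (nat \<Rightarrow> 'a \<Rightarrow> ennreal) \<Rightarrow> nat \<Rightarrow> ennreal \<Rightarrow> 'a measure" where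
  "enlarge_seq M A \<rho> 0 = A"
| "enlarge_seq M A \<rho> (Suc i) = enlarge M (enlarge_seq M A \<rho> i) (\<rho> (Suc i))"

subsection \<open>Strategies and values\<close>

definition stopping_times_from ::
  "'a measure \<Rightarrow> (ennreal \<Rightarrow> 'a measure) \<Rightarrow> ('a \<Rightarrow> ennreal) \<Rightarrow> ('a \<Rightarrow> ennreal) set" where
  "stopping_times_from M A \<sigma> = {\<tau>. stopping_time A \<tau> \<and> (\<forall>\<omega>\<in>space M. \<sigma> \<omega> \<le> \<tau> \<omega>)}"

text \<open>
  An \<open>m\<close>-tuple of stopping times is a function on \<^typ>\<open>nat\<close> of which only the values at
  \<open>1, \<dots>, m\<close> matter; likewise only \<open>\<gamma> 1, \<dots>, \<gamma> (m - 1)\<close> matter for the waiting times.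
\<close>

definition strategies ::
  "'a measure \<Rightarrow> nat \<Rightarrow> (nat \<Rightarrow> 'a \<Rightarrow> ennreal) \<Rightarrow> (ennreal \<Rightarrow> 'a measure) \<Rightarrow> ('a \<Rightarrow> ennreal) \<Rightarrow>
   (nat \<Rightarrow> 'a \<Rightarrow> ennreal) set" where
  "strategies M m \<gamma> A \<sigma> =
     {\<tau>. \<tau> 1 \<in> stopping_times_from M A \<sigma> \<and>
         (\<forall>i\<in>{2..m}. \<tau> i \<in> stopping_times_from M
            (enlarge_seq M A (\<lambda>j \<omega>. \<tau> j \<omega> + \<gamma> j \<omega>) (i - 1))
            (\<lambda>\<omega>. \<tau> (i - 1) \<omega> + \<gamma> (i - 1) \<omega>))}"

definition strategies_disc ::
  "'a measure \<Rightarrow> nat \<Rightarrow> (nat \<Rightarrow> 'a \<Rightarrow> ennreal) \<Rightarrow> (ennreal \<Rightarrow> 'a measure) \<Rightarrow> ('a \<Rightarrow> ennreal) \<Rightarrow>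
   (nat \<Rightarrow> 'a \<Rightarrow> ennreal) set" where
  "strategies_disc M m \<gamma> A \<sigma> = {\<tau>\<in>strategies M m \<gamma> A \<sigma>. countable (\<tau> 1 ` space M)}"

definition value_over ::
  "'a measure \<Rightarrow> (ennreal \<Rightarrow> 'a \<Rightarrow> ennreal) \<Rightarrow> nat \<Rightarrow> (ennreal \<Rightarrow> 'a measure) \<Rightarrow> ('a \<Rightarrow> ennreal) \<Rightarrow>
   (nat \<Rightarrow> 'a \<Rightarrow> ennreal) set \<Rightarrow> 'a \<Rightarrow> ennreal" where
  "value_over M Y m A \<sigma> S =
     family_esssup M
       ((\<lambda>\<tau>. nn_cond_exp M (filtration.pre_sigma (space M) A \<sigma>) (\<lambda>\<omega>. \<Sum>i=1..m. Y (\<tau> i \<omega>) \<omega>)) ` S)"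

definition Zval ::
  "'a measure \<Rightarrow> (ennreal \<Rightarrow> 'a \<Rightarrow> ennreal) \<Rightarrow> nat \<Rightarrow> (nat \<Rightarrow> 'a \<Rightarrow> ennreal) \<Rightarrow>
   (ennreal \<Rightarrow> 'a measure) \<Rightarrow> ('a \<Rightarrow> ennreal) \<Rightarrow> 'a \<Rightarrow> ennreal" where
  "Zval M Y m \<gamma> A \<sigma> =
     (if m = 0 then (\<lambda>_. 0) else value_over M Y m A \<sigma> (strategies M m \<gamma> A \<sigma>))"

definition Zval_disc ::
  "'a measure \<Rightarrow> (ennreal \<Rightarrow> 'a \<Rightarrow> ennreal) \<Rightarrow> nat \<Rightarrow> (nat \<Rightarrow> 'a \<Rightarrow> ennreal) \<Rightarrow>
   (ennreal \<Rightarrow> 'a measure) \<Rightarrow> ('a \<Rightarrow> ennreal) \<Rightarrow> 'a \<Rightarrow> ennreal" where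
  "Zval_disc M Y m \<gamma> A \<sigma> =
     (if m = 0 then (\<lambda>_. 0) else value_over M Y m A \<sigma> (strategies_disc M m \<gamma> A \<sigma>))"

text \<open>
  The continuation value with \<open>m\<close> exercises left after an exercise at time \<open>t\<close>. The shift
  \<open>\<lambda>i. \<delta> (Suc i)\<close> removes the first waiting time.
\<close>

definition Zbar ::
  "'a measure \<Rightarrow> (ennreal \<Rightarrow> 'a measure) \<Rightarrow> (ennreal \<Rightarrow> 'a \<Rightarrow> ennreal) \<Rightarrow> nat \<Rightarrow>
   (nat \<Rightarrow> 'a \<Rightarrow> ennreal) \<Rightarrow> ennreal \<Rightarrow> 'a \<Rightarrow> ennreal" where
  "Zbar M F Y m \<delta> t =
     nn_cond_exp M (F t)
       (Zval M Y m (\<lambda>i. \<delta> (Suc i)) (enlarge M F (\<lambda>\<omega>. t + \<delta> 1 \<omega>)) (\<lambda>\<omega>. t + \<delta> 1 \<omega>))"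

text \<open>The equality is required at \<open>t = \<infinity>\<close> as well.\<close>

definition right_continuous_modification ::
  "'a measure \<Rightarrow> (ennreal \<Rightarrow> 'a \<Rightarrow> ennreal) \<Rightarrow> (ennreal \<Rightarrow> 'a \<Rightarrow> ennreal) \<Rightarrow> bool" where
  "right_continuous_modification M X X' \<longleftrightarrow>
     (\<forall>t. X' t \<in> borel_measurable M) \<and>
     right_continuous_paths M X' \<and>
     (\<forall>t. AE \<omega> in M. X' t \<omega> = X t \<omega>)"

end

theory Submission
  imports Defs
begin

text \<open>
  Given a strategy whose first exercise time takes countably many values, on each event
  \<open>{\<tau> 1 = t}\<close> the later exercise times agree with a strategy for the filtration enlarged by the
  constant \<open>t\<close> plus the first waiting time. Conversely, strategies for these enlarged filtrations
  can be glued along the events \<open>{\<tau> = t}\<close>. Upward directedness turns the essential supremum defining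
  the continuation value into a monotone limit, so that both inequalities hold for times with
  countable range. A general stopping time is a limit from the right of such times; as everything is
  non-negative and right-continuous, Fatou's lemma suffices to pass to the limit. If the waiting
  times are stopping times, the enlargements are trivial, and an arbitrary strategy can be approximated by rounding up its first time and pushing the later ones forward.
\<close>

subsection \<open>Essential suprema and conditional expectations\<close>

text \<open>The continuation value is built separately for every deterministic \<open>t\<close>,
  each time over a different enlarged filtration and only up to a null set depending on
  \<open>t\<close>. Evaluating it at a random time is therefore direct only if that time has
  countably many values; beyond that, the link is the regularity of \<open>Zr\<close>. Fatou yields
  a bound in one direction, and this is the direction needed: the payoff at a general
  \<open>\<tau>\<close> only has to be dominated by the discrete value. A changed first time changes
  the filtration in which all later times must be stopping times, so the old later times need not be
  admissible any more. This is why only the discrete value is identified for general waiting times.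
  Instead of towers of conditional expectations, inequalities are tested by integrals over events
  \<open>B\<close> known at \<open>\<sigma>\<close>, cut into the pieces
  \<open>B \<inter> {\<tau> = t}\<close>, which are known at \<open>t\<close>.\<close>

lemma le_of_inverse_one_plus_le:
  fixes x y :: ennreal
  assumes "inverse (1 + x) \<le> inverse (1 + y)"
  shows "y \<le> x"
proof (rule ccontr)
  assume "\<not> y \<le> x"
  then have xy: "x < y" by simp
  then have "x < \<top>" by (metis top.extremum_strict less_top)
  show False
  proof (cases y)
    case (real r)
    then obtain s where s: "x = ennreal s" "0 \<le> s" "s < r" 
      using xy \<open>x < \<top>\<close> by (cases x) (auto simp: ennreal_less_iff)
    have "inverse (1 + ennreal s) = ennreal (inverse (1 + s))" "inverse (1 + ennreal r) = ennreal (inverse (1 + r))"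
      using s real by (simp_all add: inverse_ennreal ennreal_plus[symmetric] flip: ennreal_1 del: ennreal_plus)
    with assms real s show False by (auto simp: ennreal_le_iff field_simps)
  next
    case top
    with assms \<open>x < \<top>\<close> show False by (auto simp: top_add)
  qed
qed

lemma ennreal_inverse_antimono:
  fixes x y :: ennreal
  assumes "x \<le> y"
  shows "inverse y \<le> inverse x"
proof (cases "x = 0 \<or> y = \<top>")
  case False
  with assms obtain r s where "x = ennreal r" "y = ennreal s" "0 < r" "r \<le> s"
    by (cases x; cases y) (auto simp: top_unique ennreal_le_iff2 less_le)
  then show ?thesis by (simp add: inverse_ennreal ennreal_leI)
qed auto

lemma AE_le_of_nn_integral_le:
  assumes [measurable]: "f \<in> borel_measurable M" "g \<in> borel_measurable M"
    and "\<And>x. x \<in> space M \<Longrightarrow> g x \<le> f x" "(\<integral>\<^sup>+x. f x \<partial>M) \<le> (\<integral>\<^sup>+x. g x \<partial>M)" "(\<integral>\<^sup>+x. f x \<partial>M) < \<infinity>"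
  shows "AE x in M. f x \<le> g x"
proof -
  have le: "(\<integral>\<^sup>+x. g x \<partial>M) \<le> (\<integral>\<^sup>+x. f x \<partial>M)" by (intro nn_integral_mono assms)
  have "(\<integral>\<^sup>+x. f x - g x \<partial>M) = (\<integral>\<^sup>+x. f x \<partial>M) - (\<integral>\<^sup>+x. g x \<partial>M)"
    using assms le by (intro nn_integral_diff) auto
  also have "\<dots> = 0" using assms(4) by (simp add: diff_eq_0_iff_ennreal assms(5)[unfolded infinity_ennreal_def])
  finally have "AE x in M. f x - g x = 0"
    by (subst (asm) nn_integral_0_iff_AE) auto
  then show ?thesis
    by eventually_elim (metis diff_eq_0_iff_ennreal)
qed

text \<open>The countable subfamily minimises the integral of \<open>1 / (1 + sup)\<close>.\<close>

lemma (in finite_measure) ex_countable_family_esssup: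
  assumes \<Phi>: "\<Phi> \<subseteq> borel_measurable M"
  obtains C where "countable C" "C \<subseteq> \<Phi>" "is_family_esssup M \<Phi> (\<lambda>\<omega>. SUP X\<in>C. X \<omega>)"
proof -
  \<comment> \<open>Adding 1 bounds the integrand by 1, so \<open>J\<close> is finite, while
    \<open>inverse (1 + x)\<close> is still strictly decreasing on all of [0,\<infinity>]. Equality
    of the integrals will therefore force equality of the suprema.\<close>
  define J :: "('a \<Rightarrow> ennreal) set \<Rightarrow> ennreal"
    where "J C = (\<integral>\<^sup>+\<omega>. inverse (1 + (SUP X\<in>C. X \<omega>)) \<partial>M)" for C
  define \<C> where "\<C> = {C. countable C \<and> C \<subseteq> \<Phi>}"
  have meas: "(\<lambda>\<omega>. SUP X\<in>C. X \<omega>) \<in> borel_measurable M" if "C \<in> \<C>" for C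
    using that \<Phi> by (intro borel_measurable_SUP) (auto simp: \<C>_def)
  have "J ` \<C> \<noteq> {}" by (auto simp: \<C>_def)
  then obtain f :: "nat \<Rightarrow> ennreal" where f: "range f \<subseteq> J ` \<C>" "Inf (J ` \<C>) = (INF i. f i)"
    using ennreal_Inf_countable_INF[of "J ` \<C>"] by metis
  then have "\<forall>i. \<exists>C\<in>\<C>. f i = J C" by blast
  then obtain D where D: "\<And>i. D i \<in> \<C>" "\<And>i. f i = J (D i)" by metis
  \<comment> \<open>A countable union of countable families is countable, so the infimum of
    \<open>J\<close> is attained.\<close>
  define C where "C = (\<Union>i. D i)"
  have C: "C \<in> \<C>" using D(1) by (auto simp: C_def \<C>_def)
  have J_anti: "J B \<le> J A" if "A \<subseteq> B" for A B
    unfolding J_def using that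
    by (intro nn_integral_mono ennreal_inverse_antimono add_left_mono SUP_subset_mono) auto
  have J_min: "J C \<le> J B" if "B \<in> \<C>" for B
  proof -
    have "J C \<le> (INF i. f i)"
      unfolding D(2) C_def by (intro INF_greatest J_anti) auto
    also have "\<dots> \<le> J B" using that f(2) by (metis INF_lower)
    finally show ?thesis .
  qed
  have "AE \<omega> in M. X \<omega> \<le> (SUP X\<in>C. X \<omega>)" if X: "X \<in> \<Phi>" for X
  proof -
    \<comment> \<open>Adjoining one more member \<open>X\<close> cannot decrease the minimal
      \<open>J\<close>, hence it changes the supremum only on a null set.\<close>
    have XC: "insert X C \<in> \<C>" using X C by (auto simp: \<C>_def)
    have "J C \<le> (\<integral>\<^sup>+\<omega>. 1 \<partial>M)"
      unfolding J_def
      by (intro nn_integral_mono) (metis add.right_neutral add_left_mono ennreal_inverse_antimono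
          inverse_ennreal ennreal_1 inverse_1 zero_le zero_less_one)
    also have "\<dots> < \<infinity>" by (simp add: less_top[symmetric])
    finally have fin: "J C < \<infinity>" .
    have "AE \<omega> in M. inverse (1 + (SUP X\<in>C. X \<omega>)) \<le> inverse (1 + (SUP X\<in>insert X C. X \<omega>))"
      using meas[OF C] meas[OF XC] J_min[OF XC] fin unfolding J_def
      by (intro AE_le_of_nn_integral_le)
         (auto intro!: borel_measurable_inverse_ennreal ennreal_inverse_antimono add_left_mono SUP_subset_mono)
    then show ?thesis
    proof eventually_elim
      case (elim \<omega>)
      from le_of_inverse_one_plus_le[OF this] show ?case by simp
    qed
  qed
  moreover have "AE \<omega> in M. (SUP X\<in>C. X \<omega>) \<le> W \<omega>"
    if "\<forall>X\<in>\<Phi>. AE \<omega> in M. X \<omega> \<le> W \<omega>" for W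
  proof -
    have "AE \<omega> in M. \<forall>X\<in>C. X \<omega> \<le> W \<omega>"
      using that C by (subst AE_ball_countable) (auto simp: \<C>_def)
    then show ?thesis by eventually_elim (auto intro: SUP_least)
  qed
  ultimately have "is_family_esssup M \<Phi> (\<lambda>\<omega>. SUP X\<in>C. X \<omega>)"
    using meas[OF C] by (auto simp: is_family_esssup_def)
  then show thesis using that C by (auto simp: \<C>_def)
qed

lemma (in finite_measure) is_family_esssup_family_esssup:
  "\<Phi> \<subseteq> borel_measurable M \<Longrightarrow> is_family_esssup M \<Phi> (family_esssup M \<Phi>)"
  unfolding family_esssup_def by (metis ex_countable_family_esssup someI_ex)

lemma is_family_esssup_le:
  assumes "is_family_esssup M \<Phi> Z" "is_family_esssup M \<Psi> W"
    and "\<And>X. X \<in> \<Phi> \<Longrightarrow> AE \<omega> in M. X \<omega> \<le> W \<omega>"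
  shows "AE \<omega> in M. Z \<omega> \<le> W \<omega>"
  using assms unfolding is_family_esssup_def by blast

text \<open>A countable subfamily realising the essential supremum is turned into an increasing
  sequence by choosing, at each step, a member that dominates both the previous choice and the next
  enumerated one.\<close>

lemma (in finite_measure) directed_family_esssup_sequence:
  assumes \<Phi>: "\<Phi> \<subseteq> borel_measurable M" "\<Phi> \<noteq> {}"
    and dir: "\<And>X X'. X \<in> \<Phi> \<Longrightarrow> X' \<in> \<Phi> \<Longrightarrow> \<exists>W\<in>\<Phi>. AE \<omega> in M. max (X \<omega>) (X' \<omega>) \<le> W \<omega>"
    and Z: "is_family_esssup M \<Phi> Z"
  obtains X :: "nat \<Rightarrow> 'a \<Rightarrow> ennreal"
  where "\<And>k. X k \<in> \<Phi>" "\<And>k. AE \<omega> in M. X k \<omega> \<le> X (Suc k) \<omega>"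
    "AE \<omega> in M. Z \<omega> = (SUP k. X k \<omega>)"
proof -
  obtain C where C: "countable C" "C \<subseteq> \<Phi>" "is_family_esssup M \<Phi> (\<lambda>\<omega>. SUP X\<in>C. X \<omega>)"
    using ex_countable_family_esssup[OF \<Phi>(1)] .
  obtain X0 where X0: "X0 \<in> \<Phi>" using \<Phi> by blast
  \<comment> \<open>\<open>C\<close> may be empty, whereas an enumeration needs an element;
    \<open>X0\<close> supplies it.\<close>
  define e where "e = from_nat_into (insert X0 C)"
  have e: "range e = insert X0 C"
    unfolding e_def using C by (intro range_from_nat_into) auto
  then have e\<Phi>: "e k \<in> \<Phi>" for k using C(2) X0 by (metis insert_iff rangeI subsetD)
  have "\<exists>X. \<forall>k. X k \<in> \<Phi> \<and> (AE \<omega> in M. max (X k \<omega>) (e k \<omega>) \<le> X (Suc k) \<omega>)"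
    using dir e\<Phi> by (intro dependent_nat_choice) blast+
  then obtain X where X: "\<And>k. X k \<in> \<Phi>"
      "\<And>k. AE \<omega> in M. max (X k \<omega>) (e k \<omega>) \<le> X (Suc k) \<omega>" by blast
  have "AE \<omega> in M. \<forall>k. X k \<omega> \<le> Z \<omega>"
    using X(1) Z by (simp add: AE_all_countable is_family_esssup_def)
  moreover have "AE \<omega> in M. Z \<omega> \<le> (SUP X\<in>C. X \<omega>)"
    using is_family_esssup_le[OF Z C(3)] C(3) by (auto simp: is_family_esssup_def)
  moreover have "AE \<omega> in M. \<forall>k. max (X k \<omega>) (e k \<omega>) \<le> X (Suc k) \<omega>"
    using X(2) by (simp add: AE_all_countable)
  ultimately have "AE \<omega> in M. Z \<omega> = (SUP k. X k \<omega>)"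
  proof eventually_elim
    case (elim \<omega>)
    have "(SUP X\<in>C. X \<omega>) \<le> (SUP k. X k \<omega>)"
    proof (rule SUP_least)
      fix c assume "c \<in> C"
      then obtain k where "c = e k" using e by (metis insertI2 imageE)
      then show "c \<omega> \<le> (SUP k. X k \<omega>)"
        using elim(3) by (intro SUP_upper2[of "Suc k"]) auto
    qed
    with elim show ?case by (intro antisym SUP_least) auto
  qed
  then show thesis
    using X by (intro that[of X]) (auto elim: AE_mp intro!: AE_I2)
qed

section \<open>Inequalities between conditional expectations with values in [0,\<infinity>]\<close>

lemma (in sigma_finite_subalgebra) nn_cond_exp_set_nn_integral:
  assumes "B \<in> sets F" "g \<in> borel_measurable M"
  shows "(\<integral>\<^sup>+x\<in>B. nn_cond_exp M F g x \<partial>M) = (\<integral>\<^sup>+x\<in>B. g x \<partial>M)"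
  using nn_cond_exp_intg[of "indicator B" g] assms by (simp add: mult.commute)

text \<open>Integrals may be infinite, so subtracting over the set where \<open>g < h\<close> is not
  possible. Instead, splitting \<open>B\<close> along this set shows that \<open>max h g\<close> has
  the same integral as \<open>g\<close> over every \<open>B\<close>; uniqueness of the conditional
  expectation of \<open>g\<close> then identifies the two.\<close>

lemma (in sigma_finite_subalgebra) AE_le_if_set_nn_integral_le:
  assumes [measurable]: "h \<in> borel_measurable F" "g \<in> borel_measurable F"
    and le: "\<And>B. B \<in> sets F \<Longrightarrow> (\<integral>\<^sup>+x\<in>B. h x \<partial>M) \<le> (\<integral>\<^sup>+x\<in>B. g x \<partial>M)"
  shows "AE x in M. h x \<le> g x"
proof -
  have [measurable]: "h \<in> borel_measurable M" "g \<in> borel_measurable M"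
    using assms(1,2) by (auto intro: measurable_from_subalg[OF subalg])
  have "AE x in M. max (h x) (g x) = nn_cond_exp M F g x"
  proof (rule nn_cond_exp_charact)
    fix B assume B: "B \<in> sets F"
    let ?P = "{x \<in> space F. g x < h x}"
    have BP: "B \<inter> ?P \<in> sets F" "B - ?P \<in> sets F" using B by measurable
    then have [measurable]: "B \<inter> ?P \<in> sets M" "B - ?P \<in> sets M" "B \<in> sets M"
      using subalg B by (auto simp: subalgebra_def)
    have split: "(\<integral>\<^sup>+x\<in>B. f x \<partial>M) = (\<integral>\<^sup>+x\<in>B \<inter> ?P. f x \<partial>M) + (\<integral>\<^sup>+x\<in>B - ?P. f x \<partial>M)"
      if [measurable]: "f \<in> borel_measurable M" for f
      by (subst nn_integral_add[symmetric])
         (auto intro!: nn_integral_cong split: split_indicator)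
    have "(\<integral>\<^sup>+x\<in>B. max (h x) (g x) \<partial>M) = (\<integral>\<^sup>+x\<in>B \<inter> ?P. max (h x) (g x) \<partial>M) + (\<integral>\<^sup>+x\<in>B - ?P. max (h x) (g x) \<partial>M)"
      by (rule split) measurable
    also have "(\<integral>\<^sup>+x\<in>B \<inter> ?P. max (h x) (g x) \<partial>M) = (\<integral>\<^sup>+x\<in>B \<inter> ?P. h x \<partial>M)"
      by (intro nn_integral_cong) (auto split: split_indicator)
    also have "(\<integral>\<^sup>+x\<in>B - ?P. max (h x) (g x) \<partial>M) = (\<integral>\<^sup>+x\<in>B - ?P. g x \<partial>M)"
      using subalg by (intro nn_integral_cong) (auto simp: subalgebra_def max_def split: split_indicator)
    also have "(\<integral>\<^sup>+x\<in>B \<inter> ?P. h x \<partial>M) + (\<integral>\<^sup>+x\<in>B - ?P. g x \<partial>M) \<le> (\<integral>\<^sup>+x\<in>B. g x \<partial>M)"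
      by (subst split) (auto intro!: add_right_mono le BP)
    finally have "(\<integral>\<^sup>+x\<in>B. max (h x) (g x) \<partial>M) \<le> (\<integral>\<^sup>+x\<in>B. g x \<partial>M)" .
    moreover have "(\<integral>\<^sup>+x\<in>B. g x \<partial>M) \<le> (\<integral>\<^sup>+x\<in>B. max (h x) (g x) \<partial>M)"
      by (intro nn_integral_mono mult_right_mono) auto
    ultimately show "(\<integral>\<^sup>+x\<in>B. g x \<partial>M) = (\<integral>\<^sup>+x\<in>B. max (h x) (g x) \<partial>M)" by (rule antisym[rotated])
  qed measurable
  moreover have "AE x in M. g x = nn_cond_exp M F g x"
    by (rule nn_cond_exp_F_meas) measurable
  ultimately show ?thesis
    by eventually_elim (metis max.cobounded1)
qed

text \<open>The \<open>g k\<close> need not increase, and the index that nearly attains the supremum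
  may depend on \<open>B\<close>. Both are harmless, since the pointwise supremum of the conditional
  expectations dominates each of them before it is integrated.\<close>

lemma (in sigma_finite_subalgebra) nn_cond_exp_le_SUP:
  fixes g :: "nat \<Rightarrow> 'a \<Rightarrow> ennreal"
  assumes f: "f \<in> borel_measurable M" and g: "\<And>k. g k \<in> borel_measurable M"
    and le: "\<And>B. B \<in> sets F \<Longrightarrow> (\<integral>\<^sup>+x\<in>B. f x \<partial>M) \<le> (SUP k. \<integral>\<^sup>+x\<in>B. g k x \<partial>M)"
  shows "AE x in M. nn_cond_exp M F f x \<le> (SUP k. nn_cond_exp M F (g k) x)"
proof (rule AE_le_if_set_nn_integral_le)
  fix B assume B: "B \<in> sets F"
  have "(\<integral>\<^sup>+x\<in>B. nn_cond_exp M F f x \<partial>M) \<le> (SUP k. \<integral>\<^sup>+x\<in>B. nn_cond_exp M F (g k) x \<partial>M)"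
    using le[OF B] f g by (simp add: nn_cond_exp_set_nn_integral[OF B])
  also have "\<dots> \<le> (\<integral>\<^sup>+x\<in>B. (SUP k. nn_cond_exp M F (g k) x) \<partial>M)"
    by (intro SUP_least nn_integral_mono mult_right_mono SUP_upper) auto
  finally show "(\<integral>\<^sup>+x\<in>B. nn_cond_exp M F f x \<partial>M) \<le> (\<integral>\<^sup>+x\<in>B. (SUP k. nn_cond_exp M F (g k) x) \<partial>M)" .
qed measurable

text \<open>A conditional Fatou lemma: a bound common to all \<open>g k\<close> survives the limit
  without a dominating function. The tail infima \<open>h k\<close> increase to \<open>f\<close> and
  lie below \<open>g k\<close>.\<close>

lemma (in sigma_finite_subalgebra) nn_cond_exp_le_of_LIMSEQ:
  fixes g :: "nat \<Rightarrow> 'a \<Rightarrow> ennreal"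
  assumes f: "f \<in> borel_measurable M" and g[measurable]: "\<And>k. g k \<in> borel_measurable M"
    and lim: "\<And>x. x \<in> space M \<Longrightarrow> (\<lambda>k. g k x) \<longlonglongrightarrow> f x"
    and W: "\<And>k. AE x in M. nn_cond_exp M F (g k) x \<le> W x"
  shows "AE x in M. nn_cond_exp M F f x \<le> W x"
proof -
  define h where "h k x = (INF j\<in>{k..}. g j x)" for k x
  have [measurable]: "h k \<in> borel_measurable M" for k
    unfolding h_def by measurable
  have f_eq: "f x = (SUP k. h k x)" if "x \<in> space M" for x
    using lim_imp_Liminf[OF _ lim[OF that]] by (simp add: h_def liminf_SUP_INF)
  have "AE x in M. nn_cond_exp M F f x \<le> (SUP k. nn_cond_exp M F (h k) x)"
  proof (rule nn_cond_exp_le_SUP)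
    fix B assume "B \<in> sets F"
    then have [measurable]: "B \<in> sets M" using subalg by (auto simp: subalgebra_def)
    have "(\<integral>\<^sup>+x\<in>B. f x \<partial>M) = (\<integral>\<^sup>+x. (SUP k. h k x * indicator B x) \<partial>M)"
      using f_eq by (intro nn_integral_cong) (auto split: split_indicator)
    also have "\<dots> = (SUP k. \<integral>\<^sup>+x\<in>B. h k x \<partial>M)"
      by (intro nn_integral_monotone_convergence_SUP)
         (auto simp: incseq_def le_fun_def h_def intro!: mult_right_mono INF_superset_mono)
    finally show "(\<integral>\<^sup>+x\<in>B. f x \<partial>M) \<le> (SUP k. \<integral>\<^sup>+x\<in>B. h k x \<partial>M)" by simp
  qed (use f in measurable)
  moreover have "AE x in M. nn_cond_exp M F (h k) x \<le> W x" for k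
  proof -
    have "AE x in M. nn_cond_exp M F (h k) x \<le> nn_cond_exp M F (g k) x"
      by (intro nn_cond_exp_mono) (auto simp: h_def intro!: INF_lower2[of k])
    with W[of k] show ?thesis by eventually_elim simp
  qed
  then have "AE x in M. \<forall>k. nn_cond_exp M F (h k) x \<le> W x"
    by (simp add: AE_all_countable)
  ultimately show ?thesis
    by eventually_elim (meson SUP_least order_trans)
qed

subsection \<open>Right-continuous processes at random times\<close>

text \<open>The least multiple of 1/(k+1) strictly above \<open>x\<close>, with \<infinity> fixed.
  These grids are not nested, so the values need not decrease in \<open>k\<close>; what matters is
  that they converge to \<open>x\<close> from the right and lie in a countable set.\<close>

definition round_up :: "nat \<Rightarrow> ennreal \<Rightarrow> ennreal" where
  "round_up k x = (if x = \<top> then \<top>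
     else ennreal ((real_of_int \<lfloor>real (Suc k) * enn2real x\<rfloor> + 1) / real (Suc k)))"

lemma round_up_top [simp]: "round_up k \<top> = \<top>"
  by (simp add: round_up_def)

lemma measurable_round_up [measurable]: "round_up k \<in> borel \<rightarrow>\<^sub>M borel"
  unfolding round_up_def by measurable

lemma round_up_bounds:
  assumes "0 \<le> r"
  shows "ennreal r < round_up k (ennreal r)" "round_up k (ennreal r) \<le> ennreal (r + 1 / real (Suc k))"
proof -
  define z where "z = real_of_int \<lfloor>real (Suc k) * r\<rfloor>"
  have z: "real (Suc k) * r < z + 1" "z \<le> real (Suc k) * r"
    unfolding z_def by linarith+
  have eq: "round_up k (ennreal r) = ennreal ((z + 1) / real (Suc k))"
    using assms by (simp add: round_up_def z_def)
  have "r < (z + 1) / real (Suc k)"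
    using z by (simp add: pos_less_divide_eq mult.commute del: of_nat_Suc)
  moreover have "(z + 1) / real (Suc k) \<le> r + 1 / real (Suc k)"
    using z by (simp add: pos_divide_le_eq add_divide_distrib mult.commute del: of_nat_Suc)
  ultimately have "r < (z + 1) / real (Suc k)" "(z + 1) / real (Suc k) \<le> r + 1 / real (Suc k)"
    by simp_all
  with assms show "ennreal r < round_up k (ennreal r)"
    "round_up k (ennreal r) \<le> ennreal (r + 1 / real (Suc k))"
    unfolding eq by (auto intro!: ennreal_lessI ennreal_leI simp del: ennreal_plus of_nat_Suc)
qed

lemma less_round_up: "x < \<infinity> \<Longrightarrow> x < round_up k x"
  using round_up_bounds(1) by (cases x) auto

lemma le_round_up: "x \<le> round_up k x"
proof (cases "x < \<infinity>")
  case True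
  then show ?thesis by (intro less_imp_le less_round_up)
qed (simp add: not_less top_unique)

lemma round_up_less_infinity: "x < \<infinity> \<Longrightarrow> round_up k x < \<infinity>"
  by (auto simp: round_up_def)

lemma LIMSEQ_round_up: "(\<lambda>k. round_up k x) \<longlonglongrightarrow> x"
proof (cases x)
  case (real r)
  have "(\<lambda>k. r + 1 / real (Suc k)) \<longlonglongrightarrow> r + 0"
    by (rule tendsto_add[OF tendsto_const LIMSEQ_Suc[OF lim_1_over_n]])
  then have "(\<lambda>k. ennreal (r + 1 / real (Suc k))) \<longlonglongrightarrow> ennreal r"
    by (intro tendsto_ennrealI) simp
  then show ?thesis
    unfolding real(2)
    by (rule tendsto_sandwich[OF _ _ tendsto_const, rotated 2])
       (simp_all only: le_round_up round_up_bounds(2)[OF real(1)] eventually_True)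
qed simp

lemma countable_range_round_up: "countable (range (round_up k))"
proof -
  have "range (round_up k) \<subseteq> insert \<top> (range (\<lambda>z::int. ennreal ((real_of_int z + 1) / real (Suc k))))"
    by (auto simp: round_up_def)
  then show ?thesis by (rule countable_subset) simp
qed

text \<open>The event \<open>d T \<le> t\<close> depends on \<open>T\<close> alone and, as
  \<open>d\<close> never moves a time backwards, it is contained in \<open>T \<le> t\<close>; it is
  therefore already known at \<open>t\<close>.\<close>

lemma (in filtration) stopping_time_compose:
  fixes d :: "'t \<Rightarrow> 't"
  assumes T: "stopping_time F T" and d: "d \<in> borel \<rightarrow>\<^sub>M borel" and le: "\<And>x. x \<le> d x"
  shows "stopping_time F (\<lambda>\<omega>. d (T \<omega>))"
proof
  fix t
  have "(\<lambda>\<omega>. d (T \<omega>)) \<in> pre_sigma T \<rightarrow>\<^sub>M borel"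
    using measurable_compose[OF measurable_stopping_time_pre_sigma[OF T] d] .
  from measurable_sets[OF this, of "{..t}"]
  have "{\<omega>\<in>\<Omega>. d (T \<omega>) \<le> t} \<in> sets (pre_sigma T)"
    by (simp add: vimage_def Int_def space_pre_sigma conj_commute)
  from sets_pre_sigmaD[OF T this, of t]
  have "{\<omega>\<in>\<Omega>. d (T \<omega>) \<le> t \<and> T \<omega> \<le> t} \<in> sets (F t)" by simp
  also have "{\<omega>\<in>\<Omega>. d (T \<omega>) \<le> t \<and> T \<omega> \<le> t} = {\<omega>\<in>space (F t). d (T \<omega>) \<le> t}"
    using le by (auto simp: space_F intro: order_trans)
  finally show "Measurable.pred (F t) (\<lambda>\<omega>. d (T \<omega>) \<le> t)"
    by (simp add: pred_def)
qed

text \<open>The filter \<open>at_right t\<close> ignores the point \<open>t\<close>, but there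
  \<open>g\<close> already has the limiting value, so the sequence may hit \<open>t\<close>.\<close>

lemma continuous_at_right_LIMSEQ:
  fixes g :: "'t::linorder_topology \<Rightarrow> 'b::topological_space" and x :: "nat \<Rightarrow> 't"
  assumes g: "continuous (at_right t) g" and x: "x \<longlonglongrightarrow> t" and le: "\<And>k. t \<le> x k"
  shows "(\<lambda>k. g (x k)) \<longlonglongrightarrow> g t"
proof -
  have lim: "(g \<longlongrightarrow> g t) (at_right t)"
    using g by (simp add: continuous_within)
  have g': "\<forall>\<^sub>F s in nhds t. s > t \<longrightarrow> g s \<in> S" if S: "open S" "g t \<in> S" for S
    using topological_tendstoD[OF lim S] unfolding eventually_at_filter
    by (rule eventually_mono) simp
  show ?thesis
  proof (rule topological_tendstoI)
    fix S assume S: "open S" "g t \<in> S"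
    have "\<forall>\<^sub>F k in sequentially. x k > t \<longrightarrow> g (x k) \<in> S"
      using filterlim_iff[THEN iffD1, OF x, rule_format, OF g'[OF S]] .
    then show "\<forall>\<^sub>F k in sequentially. g (x k) \<in> S"
      by eventually_elim (use S le in \<open>metis order_le_less\<close>)
  qed
qed

lemma right_continuous_paths_LIMSEQ:
  fixes s :: "nat \<Rightarrow> ennreal"
  assumes X: "right_continuous_paths M X" and \<omega>: "\<omega> \<in> space M"
    and s: "s \<longlonglongrightarrow> t" "\<And>k. t \<le> s k"
  shows "(\<lambda>k. X (s k) \<omega>) \<longlonglongrightarrow> X t \<omega>"
proof (cases "t < \<infinity>")
  case True
  then show ?thesis
    using X \<omega> s continuous_at_right_LIMSEQ[of t "\<lambda>s. X s \<omega>" s]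
    by (auto simp: right_continuous_paths_def)
next
  case False
  \<comment> \<open>Right-continuity is only given at finite times; a sequence bounded below by
    \<infinity> is constant.\<close>
  then have "t = \<top>" by (simp add: not_less top_unique)
  moreover from this have "s k = \<top>" for k using s(2)[of k] by (simp add: top_unique)
  ultimately show ?thesis by simp
qed

lemma measurable_count_space_of_countable_range:
  fixes T :: "'a \<Rightarrow> ennreal"
  assumes T: "T \<in> borel_measurable M" and R: "countable R" "T ` space M \<subseteq> R"
  shows "T \<in> M \<rightarrow>\<^sub>M count_space R"
  unfolding measurable_count_space_eq_countable[OF R(1)]
proof (intro conjI ballI)
  show "T \<in> space M \<rightarrow> R" using R(2) by auto
  show "T -` {r} \<inter> space M \<in> sets M" for r using measurable_sets[OF T, of "{r}"] by simp
qed

text \<open>Along a rounded time the process is a countable patchwork of measurable maps.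
  Right-continuity recovers the general case as a limit, written as a \<open>liminf\<close> so that
  its measurability is immediate.\<close>

lemma measurable_process_at_time:
  fixes X :: "ennreal \<Rightarrow> 'a \<Rightarrow> ennreal"
  assumes X: "\<And>t. X t \<in> borel_measurable M" "right_continuous_paths M X"
    and T[measurable]: "T \<in> borel_measurable M"
  shows "(\<lambda>\<omega>. X (T \<omega>) \<omega>) \<in> borel_measurable M"
proof -
  have "(\<lambda>\<omega>. X (round_up k (T \<omega>)) \<omega>) \<in> borel_measurable M" for k
  proof (rule measurable_compose_countable'[where f=X and I="range (round_up k)"])
    show "(\<lambda>\<omega>. round_up k (T \<omega>)) \<in> M \<rightarrow>\<^sub>M count_space (range (round_up k))"
      by (rule measurable_count_space_of_countable_range) (auto simp: countable_range_round_up)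
  qed (use X(1) countable_range_round_up in auto)
  then have "(\<lambda>\<omega>. liminf (\<lambda>k. X (round_up k (T \<omega>)) \<omega>)) \<in> borel_measurable M"
    by (rule borel_measurable_liminf)
  moreover have "liminf (\<lambda>k. X (round_up k (T \<omega>)) \<omega>) = X (T \<omega>) \<omega>" if "\<omega> \<in> space M" for \<omega>
    by (rule lim_imp_Liminf[OF sequentially_bot right_continuous_paths_LIMSEQ[OF X(2) that LIMSEQ_round_up le_round_up]])
  ultimately show ?thesis
    by (rule measurable_cong[THEN iffD1, rotated])
qed

section \<open>Measurability of the value at \<infinity>\<close>

definition rational_times :: "nat \<Rightarrow> ennreal set" where
  "rational_times n = {q \<in> (\<Union>j. range (round_up j)). of_nat n < q \<and> q < \<infinity>}"

lemma countable_rational_times: "countable (rational_times n)"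
  unfolding rational_times_def
  by (rule countable_subset[of _ "\<Union>j. range (round_up j)"]) (auto simp: countable_range_round_up)

text \<open>\<open>rational_times n\<close> collects grid points of all meshes, so every real time
  beyond \<open>n\<close> is a limit from the right of its members. Right-continuity thus replaces
  each uncountable supremum by a countable one, which makes the limit superior measurable.\<close>

lemma Limsup_at_top_eq_countable:
  fixes f :: "ennreal \<Rightarrow> ennreal"
  assumes f: "\<And>t. t < \<infinity> \<Longrightarrow> continuous (at_right t) f"
  shows "Limsup at_top (\<lambda>t::real. f (ennreal t)) =
    (INF n::nat. SUP q\<in>rational_times n. f q)"
    (is "?L = _")
proof (rule antisym)
  show "?L \<le> (INF n. SUP q\<in>rational_times n. f q)"
  proof (rule INF_greatest)
    fix n :: nat
    have "?L \<le> (SUP t\<in>{real n<..}. f (ennreal t))"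
      unfolding Limsup_def
      by (intro INF_lower2[of "\<lambda>t. real n < t"]) (auto simp: eventually_gt_at_top greaterThan_def)
    also have "\<dots> \<le> (SUP q\<in>rational_times n. f q)"
    proof (rule SUP_least)
      fix t assume "t \<in> {real n<..}"
      then have t: "real n < t" "0 \<le> t" by auto
      have "(\<lambda>j. f (round_up j (ennreal t))) \<longlonglongrightarrow> f (ennreal t)"
        by (rule continuous_at_right_LIMSEQ[OF f LIMSEQ_round_up le_round_up]) simp
      moreover have "f (round_up j (ennreal t)) \<le> (SUP q\<in>rational_times n. f q)" for j
      proof (rule SUP_upper)
        have "of_nat n < ennreal t"
          using t by (simp add: ennreal_of_nat_eq_real_of_nat ennreal_lessI)
        then show "round_up j (ennreal t) \<in> rational_times n"
          using le_round_up[of "ennreal t" j] round_up_less_infinity[of "ennreal t" j]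
            by (auto simp: rational_times_def)
      qed
      ultimately show "f (ennreal t) \<le> (SUP q\<in>rational_times n. f q)"
        by (intro LIMSEQ_le_const2[of _ _ "SUP q\<in>rational_times n. f q"]) blast+
    qed
    finally show "?L \<le> (SUP q\<in>rational_times n. f q)" .
  qed
  show "(INF n. SUP q\<in>rational_times n. f q) \<le> ?L"
    unfolding Limsup_def
  proof (rule INF_greatest)
    fix P :: "real \<Rightarrow> bool" assume "P \<in> {P. eventually P at_top}"
    then obtain c where c: "\<And>t. c \<le> t \<Longrightarrow> P t" by (auto simp: eventually_at_top_linorder)
    obtain n :: nat where n: "c \<le> real n" using real_arch_simple by blast
    have "(INF n. SUP q\<in>rational_times n. f q) \<le> (SUP q\<in>rational_times n. f q)" by (rule INF_lower) simp
    also have "\<dots> \<le> (SUP t\<in>Collect P. f (ennreal t))"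
    proof (rule SUP_least)
      fix q assume q: "q \<in> rational_times n"
      then obtain t where t: "q = ennreal t" "0 \<le> t" by (cases q) (auto simp: rational_times_def)
      with q have "real n < t" by (simp add: rational_times_def ennreal_of_nat_eq_real_of_nat ennreal_less_iff)
      with c n t show "f q \<le> (SUP t\<in>Collect P. f (ennreal t))"
        by (intro SUP_upper2[of t]) auto
    qed
    finally show "(INF n. SUP q\<in>rational_times n. f q) \<le> (SUP t\<in>Collect P. f (ennreal t))" .
  qed
qed

lemma borel_measurable_Limsup_at_top:
  fixes X :: "ennreal \<Rightarrow> 'a \<Rightarrow> ennreal"
  assumes X: "\<And>t. t < \<infinity> \<Longrightarrow> X t \<in> borel_measurable M" "right_continuous_paths M X"
  shows "(\<lambda>\<omega>. Limsup at_top (\<lambda>t::real. X (ennreal t) \<omega>)) \<in> borel_measurable M"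
proof -
  have "(\<lambda>\<omega>. INF n::nat. SUP q\<in>rational_times n. X q \<omega>)
      \<in> borel_measurable M"
    using X by (intro borel_measurable_INF borel_measurable_SUP countable_rational_times)
      (auto simp: rational_times_def)
  moreover have "Limsup at_top (\<lambda>t::real. X (ennreal t) \<omega>) =
      (INF n::nat. SUP q\<in>rational_times n. X q \<omega>)"
    if "\<omega> \<in> space M" for \<omega>
    using X(2) that by (intro Limsup_at_top_eq_countable) (auto simp: right_continuous_paths_def)
  ultimately show ?thesis
    by (subst measurable_cong) auto
qed

subsection \<open>Enlargements and strategies\<close>

lemma space_adjoin_time [simp]: "space (adjoin_time M A \<rho> t) = space M"
  by (simp add: adjoin_time_def space_measure_of_conv)

lemma space_enlarge [simp]: "space (enlarge M A \<rho> t) = space M"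
  by (simp add: enlarge_def space_measure_of_conv)

lemma filtration_sets_subset_Pow:
  "filtration (space M) A \<Longrightarrow> S \<in> sets (A t) \<Longrightarrow> S \<subseteq> space M"
  using filtration.space_F sets.sets_into_space by fastforce

lemma sets_adjoin_time:
  assumes "filtration (space M) A"
  shows "sets (adjoin_time M A \<rho> t) =
    sigma_sets (space M) (sets (A t) \<union> {{\<omega>\<in>space M. \<rho> \<omega> \<le> s} | s. s \<le> t})"
  unfolding adjoin_time_def
  using filtration_sets_subset_Pow[OF assms] by (intro sets_measure_of) blast

lemma sets_adjoin_time_mono:
  assumes A: "filtration (space M) A" and "s \<le> t"
  shows "sets (adjoin_time M A \<rho> s) \<subseteq> sets (adjoin_time M A \<rho> t)"
  unfolding sets_adjoin_time[OF A] using filtration.sets_F_mono[OF A assms(2)] assms(2)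
  by (intro sigma_sets_subseteq Un_mono) (auto intro: order_trans)

lemma sets_subset_adjoin_time:
  "filtration (space M) A \<Longrightarrow> sets (A t) \<subseteq> sets (adjoin_time M A \<rho> t)"
  by (auto simp: sets_adjoin_time)

lemma le_in_sets_adjoin_time:
  "filtration (space M) A \<Longrightarrow> s \<le> t \<Longrightarrow> {\<omega>\<in>space M. \<rho> \<omega> \<le> s} \<in> sets (adjoin_time M A \<rho> t)"
  by (auto simp: sets_adjoin_time)

lemma sets_adjoin_time_subset:
  assumes A: "filtration (space M) A" and "sets (A t) \<subseteq> sets N" "space N = space M"
    and "\<And>s. s \<le> t \<Longrightarrow> {\<omega>\<in>space M. \<rho> \<omega> \<le> s} \<in> sets N"
  shows "sets (adjoin_time M A \<rho> t) \<subseteq> sets N"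
proof -
  have "sigma_sets (space N) (sets (A t) \<union> {{\<omega>\<in>space M. \<rho> \<omega> \<le> s} | s. s \<le> t}) \<subseteq> sets N"
    by (rule sets.sigma_sets_subset) (use assms in auto)
  then show ?thesis by (simp add: sets_adjoin_time[OF A] assms(3))
qed

lemma finite_times_above: "t < \<infinity> \<Longrightarrow> \<exists>s::ennreal. t < s \<and> s < \<infinity>"
  using dense by blast

lemma sets_enlarge:
  assumes A: "filtration (space M) A" and t: "t < \<infinity>"
  shows "sets (enlarge M A \<rho> t) = (\<Inter>s\<in>{t<..<\<infinity>}. sets (adjoin_time M A \<rho> s))" (is "_ = ?I")
proof -
  obtain s0 where s0: "s0 \<in> {t<..<\<infinity>}" using finite_times_above[OF t] by auto
  have "sigma_sets (space M) ?I \<subseteq> ?I"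
  proof (rule INT_greatest)
    fix s assume "s \<in> {t<..<\<infinity>}"
    then have "sigma_sets (space (adjoin_time M A \<rho> s)) ?I \<subseteq> sets (adjoin_time M A \<rho> s)"
      by (intro sets.sigma_sets_subset) auto
    then show "sigma_sets (space M) ?I \<subseteq> sets (adjoin_time M A \<rho> s)" by simp
  qed
  moreover have "?I \<subseteq> Pow (space M)"
    using INF_lower[OF s0, of "\<lambda>s. sets (adjoin_time M A \<rho> s)"]
      sets.space_closed[of "adjoin_time M A \<rho> s0"] by auto
  ultimately show ?thesis
    using t by (auto simp: enlarge_def sets_measure_of)
qed

lemma sets_enlarge_top:
  "sets (enlarge M A \<rho> \<top>) = sigma_sets (space M) (\<Union>s\<in>{..<\<infinity>}. sets (adjoin_time M A \<rho> s))"
proof -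
  have "sets (adjoin_time M A \<rho> s) \<subseteq> Pow (space M)" for s
    using sets.space_closed[of "adjoin_time M A \<rho> s"] by simp
  then have "(\<Union>s\<in>{..<\<infinity>}. sets (adjoin_time M A \<rho> s)) \<subseteq> Pow (space M)"
    by blast
  then show ?thesis by (simp add: enlarge_def sets_measure_of)
qed

lemma filtration_enlarge:
  assumes A: "filtration (space M) A"
  shows "filtration (space M) (enlarge M A \<rho>)"
proof
  fix s t :: ennreal assume st: "s \<le> t"
  show "sets (enlarge M A \<rho> s) \<subseteq> sets (enlarge M A \<rho> t)"
  proof (cases "t < \<infinity>")
    case True
    then show ?thesis
      using st by (auto simp: sets_enlarge[OF A] dest: le_less_trans)
  next
    case False
    then have t: "t = \<top>" by (simp add: not_less top_unique)
    show ?thesis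
    proof (cases "s < \<infinity>")
      case True
      then obtain r where "s < r" "r < \<infinity>" using finite_times_above by blast
      then show ?thesis
        using True by (auto simp: t sets_enlarge[OF A] sets_enlarge_top intro!: sigma_sets.Basic)
    next
      case False
      with t show ?thesis by (simp add: not_less top_unique)
    qed
  qed
qed simp

lemma sets_subset_enlarge:
  assumes A: "filtration (space M) A" and "t < \<infinity>"
  shows "sets (A t) \<subseteq> sets (enlarge M A \<rho> t)"
  unfolding sets_enlarge[OF assms]
  using sets_subset_adjoin_time[OF A, of _ \<rho>] filtration.sets_F_mono[OF A, of t]
  by (intro INT_greatest) (metis greaterThanLessThan_iff less_imp_le order_trans)

lemma stopping_time_iff_sets:
  fixes A :: "ennreal \<Rightarrow> 'a measure" and T :: "'a \<Rightarrow> ennreal"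
  assumes A: "filtration (space M) A"
  shows "stopping_time A T \<longleftrightarrow> (\<forall>t<\<infinity>. {\<omega>\<in>space M. T \<omega> \<le> t} \<in> sets (A t))"
proof -
  have *: "Measurable.pred (A t) P \<longleftrightarrow> {\<omega>\<in>space M. P \<omega>} \<in> sets (A t)" for t P
    by (simp add: pred_def filtration.space_F[OF A])
  have "{\<omega>\<in>space M. T \<omega> \<le> t} \<in> sets (A t)" if "\<not> t < \<infinity>" for t
  proof -
    have "t = \<top>" using that by (simp add: not_less top_unique)
    then show ?thesis using sets.top[of "A t"] by (simp add: filtration.space_F[OF A])
  qed
  then show ?thesis
    unfolding stopping_time_def * by blast
qed

lemma stopping_time_enlarge:
  assumes A: "filtration (space M) A"
  shows "stopping_time (enlarge M A \<rho>) \<rho>"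
  unfolding stopping_time_iff_sets[OF filtration_enlarge[OF A]]
  by (auto simp: sets_enlarge[OF A] intro!: le_in_sets_adjoin_time[OF A])

lemma sets_enlarge_subset:
  assumes A: "filtration (space M) A" and "\<And>t. sets (A t) \<subseteq> sets M" and "\<rho> \<in> borel_measurable M"
  shows "sets (enlarge M A \<rho> t) \<subseteq> sets M"
proof -
  have "{\<omega>\<in>space M. \<rho> \<omega> \<le> s} \<in> sets M" for s
    using measurable_sets[OF assms(3), of "{..s}"] by (simp add: vimage_def Int_def conj_commute)
  then have adj: "sets (adjoin_time M A \<rho> t) \<subseteq> sets M" for t
    by (intro sets_adjoin_time_subset assms) auto
  then have "sets (enlarge M A \<rho> \<top>) \<subseteq> sets M"
    unfolding sets_enlarge_top by (intro sets.sigma_sets_subset) auto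
  moreover have "sets (enlarge M A \<rho> t) \<subseteq> sets (enlarge M A \<rho> \<top>)"
    by (rule filtration.sets_F_mono[OF filtration_enlarge[OF A]]) simp
  ultimately show ?thesis by blast
qed

lemma filtration_enlarge_seq:
  "filtration (space M) A \<Longrightarrow> filtration (space M) (enlarge_seq M A \<rho> i)"
  by (induction i) (auto intro: filtration_enlarge)

lemma sets_enlarge_seq_subset:
  assumes A: "filtration (space M) A" "\<And>t. sets (A t) \<subseteq> sets M"
    and "\<And>j. j \<in> {1..i} \<Longrightarrow> \<rho> j \<in> borel_measurable M"
  shows "sets (enlarge_seq M A \<rho> i t) \<subseteq> sets M"
  using assms(3)
proof (induction i arbitrary: t)
  case (Suc i)
  have "sets (enlarge M (enlarge_seq M A \<rho> i) (\<rho> (Suc i)) t) \<subseteq> sets M"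
    using Suc by (intro sets_enlarge_subset filtration_enlarge_seq A) auto
  then show ?case by simp
qed (simp add: A)

text \<open>The recursion adjoins the last time last. Here the first time is split off instead, as
  is needed to pass to the problem that remains after the first exercise.\<close>

lemma enlarge_seq_Suc_shift:
  "enlarge_seq M A \<rho> (Suc i) = enlarge_seq M (enlarge M A (\<rho> 1)) (\<lambda>j. \<rho> (Suc j)) i"
  by (induction i) auto

lemma enlarge_seq_cong:
  "(\<And>j. j \<in> {1..i} \<Longrightarrow> \<rho> j = \<rho>' j) \<Longrightarrow> enlarge_seq M A \<rho> i = enlarge_seq M A \<rho>' i"
  by (induction i) auto

text \<open>\<open>D u\<close> is the part of an event that is already known at time \<open>u\<close>. On it, enlargements by times
  that agree there carry the same information.\<close>

lemma enlarge_trace: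
  assumes A: "filtration (space M) A" and A': "filtration (space M) A'"
    and D: "\<And>u v. u \<le> v \<Longrightarrow> D u \<subseteq> D v" "\<And>u. D u \<subseteq> space M"
    and base: "\<And>u S. u < \<infinity> \<Longrightarrow> S \<in> sets (A u) \<Longrightarrow> S \<inter> D u \<in> sets (A' u)"
    and eq: "\<And>u \<omega>. u < \<infinity> \<Longrightarrow> \<omega> \<in> D u \<Longrightarrow> \<rho> \<omega> = \<rho>' \<omega>"
    and u: "u < \<infinity>" and S: "S \<in> sets (enlarge M A \<rho> u)"
  shows "S \<inter> D u \<in> sets (enlarge M A' \<rho>' u)"
proof -
  \<comment> \<open>The trace of the whole space shows that \<open>D u\<close> itself is known at
    time \<open>u\<close>.\<close>
  have D_in: "D u \<in> sets (A' u)" if "u < \<infinity>" for u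
    using base[OF that sets.top] D(2)[of u] by (simp add: filtration.space_F[OF A] Int_absorb1)
  then have D_adj: "D u \<in> sets (adjoin_time M A' \<rho>' v)" if "u \<le> v" "u < \<infinity>" for u v
    using that sets_subset_adjoin_time[OF A', of u \<rho>'] sets_adjoin_time_mono[OF A' that(1), of \<rho>']
    by blast
  have adj: "S \<inter> D v \<in> sets (adjoin_time M A' \<rho>' v)"
    if v: "v < \<infinity>" and "S \<in> sets (adjoin_time M A \<rho> v)" for v S
    using that(2) unfolding sets_adjoin_time[OF A]
  proof (induction rule: sigma_sets.induct)
    case (Basic a)
    then consider "a \<in> sets (A v)" | s where "s \<le> v" "a = {\<omega>\<in>space M. \<rho> \<omega> \<le> s}" by blast
    then show ?case
    proof cases
      case 1
      then show ?thesis using base[OF v] sets_subset_adjoin_time[OF A', of v \<rho>'] by blast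
    next
      case 2
      then have "a \<inter> D v = {\<omega>\<in>space M. \<rho>' \<omega> \<le> s} \<inter> D v" using eq[OF v] by auto
      then show ?thesis
        using le_in_sets_adjoin_time[OF A' 2(1), of \<rho>'] D_adj[of v v] v by auto
    qed
  next
    case (Compl a)
    have "(space M - a) \<inter> D v = D v - a \<inter> D v" using D(2)[of v] by auto
    then show ?case using Compl D_adj[of v v] v by auto
  next
    case (Union a)
    have "\<Union> (range a) \<inter> D v = (\<Union>i. a i \<inter> D v)" by auto
    moreover have "(\<Union>i. a i \<inter> D v) \<in> sets (adjoin_time M A' \<rho>' v)"
      by (intro sets.countable_UN) (use Union in auto)
    ultimately show ?case by simp
  qed simp
  show ?thesis
    unfolding sets_enlarge[OF A' u]
  proof (rule INT_I)
    fix v assume v: "v \<in> {u<..<\<infinity>}"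
    then have "S \<inter> D v \<in> sets (adjoin_time M A' \<rho>' v)"
      using S adj by (auto simp: sets_enlarge[OF A u])
    moreover have "D u \<in> sets (adjoin_time M A' \<rho>' v)"
      using v u by (intro D_adj) auto
    \<comment> \<open>The right limit looks past \<open>u\<close>, where a larger part
      \<open>D v\<close> counts; monotonicity of \<open>D\<close> allows the result to be cut back
      to \<open>D u\<close>.\<close>
    moreover have "S \<inter> D u = (S \<inter> D v) \<inter> D u" using D(1)[of u v] v by (auto dest: less_imp_le)
    ultimately show "S \<inter> D u \<in> sets (adjoin_time M A' \<rho>' v)" by auto
  qed
qed

lemma enlarge_seq_trace:
  assumes A: "filtration (space M) A"
    and D: "\<And>u v. u \<le> v \<Longrightarrow> D u \<subseteq> D v" "\<And>u. u < \<infinity> \<Longrightarrow> D u \<in> sets (A u)" "\<And>u. D u \<subseteq> space M"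
    and eq: "\<And>j u \<omega>. j \<in> {1..i} \<Longrightarrow> u < \<infinity> \<Longrightarrow> \<omega> \<in> D u \<Longrightarrow> \<rho> j \<omega> = \<rho>' j \<omega>"
    and "u < \<infinity>" "S \<in> sets (enlarge_seq M A \<rho> i u)"
  shows "S \<inter> D u \<in> sets (enlarge_seq M A \<rho>' i u)"
  using eq \<open>u < \<infinity>\<close> \<open>S \<in> _\<close>
proof (induction i arbitrary: u S)
  case (Suc i)
  show ?case
    unfolding enlarge_seq.simps
  proof (rule enlarge_trace)
    show "filtration (space M) (enlarge_seq M A \<rho> i)" "filtration (space M) (enlarge_seq M A \<rho>' i)"
      by (intro filtration_enlarge_seq A)+
    show "S \<in> sets (enlarge M (enlarge_seq M A \<rho> i) (\<rho> (Suc i)) u)" using Suc.prems by simp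
  qed (use Suc D in auto)
qed (use D in auto)

text \<open>The index range is \<open>{1..max 1 m}\<close> because \<open>strategies\<close>
  constrains the first time even for \<open>m = 0\<close>.\<close>

lemma strategiesD:
  assumes "T \<in> strategies M m \<gamma> A \<sigma>"
  shows "i \<in> {1..max 1 m} \<Longrightarrow>
      stopping_time (enlarge_seq M A (\<lambda>j \<omega>. T j \<omega> + \<gamma> j \<omega>) (i - 1)) (T i)"
    and "\<omega> \<in> space M \<Longrightarrow> \<sigma> \<omega> \<le> T 1 \<omega>"
    and "i \<in> {1..<m} \<Longrightarrow> \<omega> \<in> space M \<Longrightarrow> T i \<omega> + \<gamma> i \<omega> \<le> T (Suc i) \<omega>"
proof -
  show "stopping_time (enlarge_seq M A (\<lambda>j \<omega>. T j \<omega> + \<gamma> j \<omega>) (i - 1)) (T i)"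
    if i: "i \<in> {1..max 1 m}"
  proof (cases "i = 1")
    case True
    then show ?thesis using assms by (auto simp: strategies_def stopping_times_from_def)
  next
    case False
    with i have "i \<in> {2..m}" by auto
    then show ?thesis using assms unfolding strategies_def stopping_times_from_def by blast
  qed
  show "\<sigma> \<omega> \<le> T 1 \<omega>" if "\<omega> \<in> space M"
    using that assms by (auto simp: strategies_def stopping_times_from_def)
  show "T i \<omega> + \<gamma> i \<omega> \<le> T (Suc i) \<omega>" if "i \<in> {1..<m}" "\<omega> \<in> space M"
  proof -
    have "Suc i \<in> {2..m}" using that by auto
    then have "T (Suc i - 1) \<omega> + \<gamma> (Suc i - 1) \<omega> \<le> T (Suc i) \<omega>"
      using that assms unfolding strategies_def stopping_times_from_def by blast
    then show ?thesis by simp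
  qed
qed

lemma strategiesI:
  assumes "\<And>i. i \<in> {1..max 1 m} \<Longrightarrow>
      stopping_time (enlarge_seq M A (\<lambda>j \<omega>. T j \<omega> + \<gamma> j \<omega>) (i - 1)) (T i)"
    and "\<And>\<omega>. \<omega> \<in> space M \<Longrightarrow> \<sigma> \<omega> \<le> T 1 \<omega>"
    and "\<And>i \<omega>. i \<in> {1..<m} \<Longrightarrow> \<omega> \<in> space M \<Longrightarrow> T i \<omega> + \<gamma> i \<omega> \<le> T (Suc i) \<omega>"
  shows "T \<in> strategies M m \<gamma> A \<sigma>"
proof -
  have "T (i - 1) \<omega> + \<gamma> (i - 1) \<omega> \<le> T i \<omega>" if "i \<in> {2..m}" "\<omega> \<in> space M" for i \<omega>
  proof -
    have "Suc (i - 1) = i" "i - 1 \<in> {1..<m}" using that by auto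
    then show ?thesis using assms(3)[of "i - 1" \<omega>] that(2) by simp
  qed
  moreover have "stopping_time (enlarge_seq M A (\<lambda>j \<omega>. T j \<omega> + \<gamma> j \<omega>) (i - 1)) (T i)" if "i \<in> {2..m}" for i
    using assms(1)[of i] that by auto
  moreover have "stopping_time A (T 1)" using assms(1)[of 1] by simp
  ultimately show ?thesis
    using assms(2) by (auto simp: strategies_def stopping_times_from_def)
qed

lemma strategies_iff:
  "T \<in> strategies M m \<gamma> A \<sigma> \<longleftrightarrow>
    (\<forall>i\<in>{1..max 1 m}. stopping_time (enlarge_seq M A (\<lambda>j \<omega>. T j \<omega> + \<gamma> j \<omega>) (i - 1)) (T i)) \<and>
    (\<forall>\<omega>\<in>space M. \<sigma> \<omega> \<le> T 1 \<omega>) \<and>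
    (\<forall>i\<in>{1..<m}. \<forall>\<omega>\<in>space M. T i \<omega> + \<gamma> i \<omega> \<le> T (Suc i) \<omega>)" (is "_ \<longleftrightarrow> ?R")
proof
  show ?R if "T \<in> strategies M m \<gamma> A \<sigma>"
    using strategiesD[OF that] by blast
  show "T \<in> strategies M m \<gamma> A \<sigma>" if ?R
    using that by (intro strategiesI) blast+
qed

lemma strategies_first_le:
  assumes "T \<in> strategies M m \<gamma> A \<sigma>" "\<omega> \<in> space M" "i \<in> {1..max 1 m}"
  shows "T 1 \<omega> \<le> T i \<omega>"
proof -
  have "i \<le> max 1 m \<Longrightarrow> T 1 \<omega> \<le> T i \<omega>" if "1 \<le> i" for i
    using that
  proof (induction i rule: nat_induct_at_least)
    case (Suc i)
    then have "T 1 \<omega> \<le> T i \<omega>" by simp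
    also have "\<dots> \<le> T i \<omega> + \<gamma> i \<omega>" by simp
    also have "\<dots> \<le> T (Suc i) \<omega>"
      using Suc by (intro strategiesD(3)[OF assms(1) _ assms(2)]) auto
    finally show ?case .
  qed simp
  with assms(3) show ?thesis by auto
qed

text \<open>Strong induction is forced by the enlargements: that the filtration of
  \<open>T i\<close> stays inside \<open>M\<close> depends on the measurability of all earlier
  times, which generate it.\<close>

lemma measurable_strategies:
  assumes A: "filtration (space M) A" "\<And>t. sets (A t) \<subseteq> sets M"
    and T: "T \<in> strategies M m \<gamma> A \<sigma>"
    and \<gamma>: "\<And>i. i \<in> {1..<m} \<Longrightarrow> \<gamma> i \<in> borel_measurable M"
    and i: "i \<in> {1..max 1 m}"
  shows "T i \<in> borel_measurable M"
  using i
proof (induction i rule: less_induct)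
  case (less i)
  have "sets (enlarge_seq M A (\<lambda>j \<omega>. T j \<omega> + \<gamma> j \<omega>) (i - 1) t) \<subseteq> sets M" for t
  proof (rule sets_enlarge_seq_subset[OF A])
    fix j assume j: "j \<in> {1..i - 1}"
    have [measurable]: "T j \<in> borel_measurable M" using j less.prems by (intro less.IH) auto
    have [measurable]: "\<gamma> j \<in> borel_measurable M" using j less.prems by (intro \<gamma>) auto
    show "(\<lambda>\<omega>. T j \<omega> + \<gamma> j \<omega>) \<in> borel_measurable M" by measurable
  qed
  then show ?case
    using filtration.space_F[OF filtration_enlarge_seq[OF A(1)]]
    by (intro measurable_stopping_time[OF strategiesD(1)[OF T less.prems]]) auto
qed

text \<open>The hypothesis on \<open>c\<close> says that the choice is known at the first exercise time it leads to.\<close>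

lemma strategies_paste:
  fixes T :: "'i \<Rightarrow> nat \<Rightarrow> 'a \<Rightarrow> ennreal" and c :: "'a \<Rightarrow> 'i"
  assumes A: "filtration (space M) A" and I: "countable I" "\<And>\<omega>. \<omega> \<in> space M \<Longrightarrow> c \<omega> \<in> I"
    and T: "\<And>k. k \<in> I \<Longrightarrow> T k \<in> strategies M m \<gamma> A (\<sigma>' k)"
    and c: "\<And>k u. k \<in> I \<Longrightarrow> u < \<infinity> \<Longrightarrow> {\<omega>\<in>space M. c \<omega> = k \<and> T k 1 \<omega> \<le> u} \<in> sets (A u)"
    and \<sigma>: "\<And>\<omega>. \<omega> \<in> space M \<Longrightarrow> \<sigma> \<omega> \<le> T (c \<omega>) 1 \<omega>"
  shows "(\<lambda>i \<omega>. T (c \<omega>) i \<omega>) \<in> strategies M m \<gamma> A \<sigma>" (is "?S \<in> _")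
proof (rule strategiesI)
  fix i assume i: "i \<in> {1..max 1 m}"
  let ?E = "\<lambda>T. enlarge_seq M A (\<lambda>j \<omega>. T j \<omega> + \<gamma> j \<omega>) (i - 1)"
  show "stopping_time (?E ?S) (?S i)"
    unfolding stopping_time_iff_sets[OF filtration_enlarge_seq[OF A]]
  proof (intro allI impI)
    fix u :: ennreal assume u: "u < \<infinity>"
    \<comment> \<open>On \<open>c \<omega> = k\<close> the pasted times are those of
      \<open>T k\<close>; \<open>D k u\<close> is the part of this event that is recognised by time
      \<open>u\<close>.\<close>
    define D where "D k u = {\<omega>\<in>space M. c \<omega> = k \<and> T k 1 \<omega> \<le> u}" for k u
    have "{\<omega>\<in>space M. T k i \<omega> \<le> u} \<inter> D k u \<in> sets (?E ?S u)" if k: "k \<in> I" for k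
    proof (rule enlarge_seq_trace[OF A _ _ _ _ u])
      show "{\<omega>\<in>space M. T k i \<omega> \<le> u} \<in> sets (?E (T k) u)"
        using strategiesD(1)[OF T[OF k] i] u
        by (simp add: stopping_time_iff_sets[OF filtration_enlarge_seq[OF A]])
    qed (use c[OF k] in \<open>auto simp: D_def\<close>)
    then have "(\<Union>k\<in>I. {\<omega>\<in>space M. T k i \<omega> \<le> u} \<inter> D k u) \<in> sets (?E ?S u)"
      using I(1) by (intro sets.countable_UN') auto
    \<comment> \<open>Restricting to \<open>D k u\<close> loses nothing: the first exercise is the
      earliest, so \<open>T k i \<omega> \<le> u\<close> entails
      \<open>T k 1 \<omega> \<le> u\<close>.\<close>
    also have "(\<Union>k\<in>I. {\<omega>\<in>space M. T k i \<omega> \<le> u} \<inter> D k u) = {\<omega>\<in>space M. ?S i \<omega> \<le> u}"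
      using I(2) order_trans[OF strategies_first_le[OF T _ i]] by (auto simp: D_def)
    finally show "{\<omega>\<in>space M. ?S i \<omega> \<le> u} \<in> sets (?E ?S u)" .
  qed
next
  show "?S i \<omega> + \<gamma> i \<omega> \<le> ?S (Suc i) \<omega>" if "i \<in> {1..<m}" "\<omega> \<in> space M" for i \<omega>
    by (rule strategiesD(3)[OF T[OF I(2)[OF that(2)]] that])
qed (rule \<sigma>)

text \<open>Splitting off the first exercise leaves the kind of problem that defines the
  continuation value. The equivalence starts at \<open>m = 1\<close>: for \<open>m = 0\<close> the
  left side says nothing about a second time, whereas \<open>strategies\<close> restricts the first
  time of any tuple.\<close>

lemma strategies_Suc_iff:
  assumes "m \<ge> 1"
  shows "T \<in> strategies M (Suc m) \<gamma> A \<sigma> \<longleftrightarrow>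
    T 1 \<in> stopping_times_from M A \<sigma> \<and>
    (\<lambda>i. T (Suc i)) \<in> strategies M m (\<lambda>i. \<gamma> (Suc i)) (enlarge M A (\<lambda>\<omega>. T 1 \<omega> + \<gamma> 1 \<omega>)) (\<lambda>\<omega>. T 1 \<omega> + \<gamma> 1 \<omega>)"
proof -
  let ?E = "enlarge_seq M A (\<lambda>j \<omega>. T j \<omega> + \<gamma> j \<omega>)"
  let ?E' = "enlarge_seq M (enlarge M A (\<lambda>\<omega>. T 1 \<omega> + \<gamma> 1 \<omega>)) (\<lambda>j \<omega>. T (Suc j) \<omega> + \<gamma> (Suc j) \<omega>)"
  have E: "?E i = ?E' (i - 1)" if "i \<in> {1..m}" for i
    using that enlarge_seq_Suc_shift[of M A "\<lambda>j \<omega>. T j \<omega> + \<gamma> j \<omega>" "i - 1"] by simp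
  have E: "(\<forall>i\<in>{1..m}. stopping_time (?E (Suc i - 1)) (T (Suc i))) \<longleftrightarrow>
      (\<forall>i\<in>{1..m}. stopping_time (?E' (i - 1)) (T (Suc i)))"
    using E by (intro ball_cong) auto
  have max: "max 1 (Suc m) = Suc m" "max 1 m = m"
    and split: "{1..Suc m} = insert 1 (Suc ` {1..m})" "{1..<Suc m} = insert 1 (Suc ` {1..<m})"
    using assms by (auto simp: image_Suc_atLeastAtMost image_Suc_atLeastLessThan)
  have E1: "?E (1 - 1) = A" by simp
  show ?thesis
    unfolding strategies_iff stopping_times_from_def max split Set.ball_simps(7,9) E E1 mem_Collect_eq
    by blast
qed

subsection \<open>Continuation values\<close>

text \<open>Writing the sum over the values of \<open>T\<close> as an integral for the counting
  measure makes monotonicity and monotone convergence applicable to the sum.\<close>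

lemma nn_integral_countable_partition:
  fixes T :: "'a \<Rightarrow> 'i"
  assumes f: "f \<in> borel_measurable M" and R: "countable R" "T ` space M \<subseteq> R"
    and T: "\<And>t. t \<in> R \<Longrightarrow> {\<omega>\<in>space M. T \<omega> = t} \<in> sets M"
  shows "(\<integral>\<^sup>+\<omega>. f \<omega> \<partial>M) = (\<integral>\<^sup>+t. (\<integral>\<^sup>+\<omega>. f \<omega> * indicator {\<omega>\<in>space M. T \<omega> = t} \<omega> \<partial>M) \<partial>count_space R)"
proof -
  have "(\<integral>\<^sup>+\<omega>. f \<omega> \<partial>M) = (\<integral>\<^sup>+\<omega>. (\<integral>\<^sup>+t. f \<omega> * indicator {\<omega>\<in>space M. T \<omega> = t} \<omega> \<partial>count_space R) \<partial>M)"
  proof (rule nn_integral_cong)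
    fix \<omega> assume \<omega>: "\<omega> \<in> space M"
    have "(\<integral>\<^sup>+t. f \<omega> * indicator {\<omega>\<in>space M. T \<omega> = t} \<omega> \<partial>count_space R) =
        (\<integral>\<^sup>+t. f \<omega> * indicator {T \<omega>} t \<partial>count_space R)"
      using \<omega> by (intro nn_integral_cong) (auto split: split_indicator)
    also have "\<dots> = f \<omega>"
      using R(2) \<omega> by (subst nn_integral_cmult_indicator) (auto simp: one_ennreal_def[symmetric])
    finally show "f \<omega> = (\<integral>\<^sup>+t. f \<omega> * indicator {\<omega>\<in>space M. T \<omega> = t} \<omega> \<partial>count_space R)" ..
  qed
  also have "\<dots> = (\<integral>\<^sup>+t. (\<integral>\<^sup>+\<omega>. f \<omega> * indicator {\<omega>\<in>space M. T \<omega> = t} \<omega> \<partial>M) \<partial>count_space R)"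
    by (intro nn_integral_count_space_nn_integral R(1) borel_measurable_times_ennreal f
        borel_measurable_indicator T)
  finally show ?thesis .
qed

lemma subalgebra_pre_sigma:
  fixes A :: "ennreal \<Rightarrow> 'a measure"
  assumes A: "filtration (space M) A" "\<And>t. sets (A t) \<subseteq> sets M" and \<sigma>: "stopping_time A \<sigma>"
  shows "subalgebra M (filtration.pre_sigma (space M) A \<sigma>)"
proof -
  have "B \<in> sets M" if "B \<in> sets (filtration.pre_sigma (space M) A \<sigma>)" for B
    using filtration.sets_pre_sigmaD[OF A(1) \<sigma> that, of \<top>] A(2) by auto
  then show ?thesis
    by (auto simp: subalgebra_def filtration.space_pre_sigma[OF A(1)])
qed

text \<open>Where \<open>\<tau> = t\<close>, also \<open>\<sigma> \<le> t\<close>, so the part of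
  \<open>B\<close> lying there is known at \<open>t\<close>. This turns test events at
  \<open>\<sigma>\<close> into test events at deterministic times.\<close>

lemma (in filtration) Int_eq_const_in_sets:
  assumes "stopping_time F \<sigma>" "stopping_time F \<tau>" "\<And>\<omega>. \<omega> \<in> \<Omega> \<Longrightarrow> \<sigma> \<omega> \<le> \<tau> \<omega>"
    and B: "B \<in> sets (pre_sigma \<sigma>)"
  shows "B \<inter> {\<omega>\<in>\<Omega>. \<tau> \<omega> = t} \<in> sets (F t)"
proof -
  have "{\<omega>\<in>B. \<sigma> \<omega> \<le> t} \<inter> {\<omega>\<in>\<Omega>. \<tau> \<omega> = t} \<in> sets (F t)"
    using sets_pre_sigmaD[OF assms(1) B, of t] stopping_time_eq_const[OF assms(2), of t]
    by (auto simp: pred_def space_F)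
  also have "{\<omega>\<in>B. \<sigma> \<omega> \<le> t} \<inter> {\<omega>\<in>\<Omega>. \<tau> \<omega> = t} = B \<inter> {\<omega>\<in>\<Omega>. \<tau> \<omega> = t}"
    using assms(3) by auto
  finally show ?thesis .
qed

lemma const_top_in_strategies: "(\<lambda>_ _. \<top>) \<in> strategies M m \<gamma> A \<sigma>"
  by (intro strategiesI stopping_time_const) auto

text \<open>Index 0 is unconstrained. In the tail \<open>\<lambda>i. T (Suc i)\<close> it holds the
  first time of \<open>T\<close>, so it must be possible to prescribe it.\<close>

lemma strategies_fun_upd_0:
  assumes "T \<in> strategies M m \<gamma> A \<sigma>"
  shows "T(0 := f) \<in> strategies M m \<gamma> A \<sigma>"
proof (rule strategiesI)
  fix i assume i: "i \<in> {1..max 1 m}"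
  have "enlarge_seq M A (\<lambda>j \<omega>. (T(0 := f)) j \<omega> + \<gamma> j \<omega>) (i - 1) = enlarge_seq M A (\<lambda>j \<omega>. T j \<omega> + \<gamma> j \<omega>) (i - 1)"
    by (rule enlarge_seq_cong) auto
  then show "stopping_time (enlarge_seq M A (\<lambda>j \<omega>. (T(0 := f)) j \<omega> + \<gamma> j \<omega>) (i - 1)) ((T(0 := f)) i)"
    using strategiesD(1)[OF assms i] i by simp
qed (use strategiesD(2,3)[OF assms] in auto)

section \<open>Continuation value after a first exercise at a fixed time\<close>

locale reward_process = usual_filtration M F
  for M :: "'a measure" and F :: "ennreal \<Rightarrow> 'a measure" +
  fixes Y :: "ennreal \<Rightarrow> 'a \<Rightarrow> ennreal"
  assumes measurable_Y: "Y t \<in> borel_measurable M"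
    and right_continuous_Y: "right_continuous_paths M Y"
begin

abbreviation reward :: "nat \<Rightarrow> (nat \<Rightarrow> 'a \<Rightarrow> ennreal) \<Rightarrow> 'a \<Rightarrow> ennreal" where
  "reward m T \<equiv> (\<lambda>\<omega>. \<Sum>i=1..m. Y (T i \<omega>) \<omega>)"

abbreviation cond_reward ::
  "(ennreal \<Rightarrow> 'a measure) \<Rightarrow> ('a \<Rightarrow> ennreal) \<Rightarrow> nat \<Rightarrow> (nat \<Rightarrow> 'a \<Rightarrow> ennreal) \<Rightarrow> 'a \<Rightarrow> ennreal" where
  "cond_reward A \<sigma> m T \<equiv> nn_cond_exp M (filtration.pre_sigma (space M) A \<sigma>) (reward m T)"

lemma filtration_F: "filtration (space M) F" by unfold_locales

lemma sets_F_subset: "sets (F t) \<subseteq> sets M"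
  using subalgebra_F by (auto simp: subalgebra_def)

lemma sigma_finite_subalgebraI: "subalgebra M G \<Longrightarrow> sigma_finite_subalgebra M G"
  by (intro finite_measure_subalgebra_is_sigma_finite finite_measure_subalgebra.intro
      finite_measure_subalgebra_axioms.intro finite_measure_axioms)

lemma reward_Suc: "reward (Suc m) T \<omega> = Y (T 1 \<omega>) \<omega> + reward m (\<lambda>i. T (Suc i)) \<omega>"
  by (simp add: sum.atLeast_Suc_atMost sum.shift_bounds_cl_Suc_ivl del: sum.cl_ivl_Suc)

lemma measurable_reward:
  assumes "\<And>i. i \<in> {1..m} \<Longrightarrow> T i \<in> borel_measurable M"
  shows "reward m T \<in> borel_measurable M"
  by (intro borel_measurable_sum measurable_process_at_time[OF measurable_Y right_continuous_Y] assms)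

lemma is_family_esssup_value_over:
  "is_family_esssup M (cond_reward A \<sigma> m ` S) (value_over M Y m A \<sigma> S)"
  unfolding value_over_def by (intro is_family_esssup_family_esssup) auto

text \<open>The better strategy can be selected at \<open>\<sigma>\<close>: comparing the two
  conditional rewards is an event known at \<open>\<sigma>\<close>, hence known when either strategy
  makes its first exercise. Indicators of such events pass through the conditional expectation, so
  the pasted strategy attains the maximum.\<close>

lemma cond_reward_directed:
  assumes A: "filtration (space M) A" "\<And>t. sets (A t) \<subseteq> sets M" and \<sigma>: "stopping_time A \<sigma>"
    and \<gamma>: "\<And>i. i \<in> {1..<m} \<Longrightarrow> \<gamma> i \<in> borel_measurable M"
    and T: "T \<in> strategies M m \<gamma> A \<sigma>" and T': "T' \<in> strategies M m \<gamma> A \<sigma>"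
  shows "\<exists>S\<in>strategies M m \<gamma> A \<sigma>.
    AE \<omega> in M. max (cond_reward A \<sigma> m T \<omega>) (cond_reward A \<sigma> m T' \<omega>) \<le> cond_reward A \<sigma> m S \<omega>"
proof -
  let ?G = "filtration.pre_sigma (space M) A \<sigma>"
  have sub: "subalgebra M ?G" by (rule subalgebra_pre_sigma[OF A \<sigma>])
  interpret G: sigma_finite_subalgebra M ?G
    by (rule sigma_finite_subalgebraI[OF sub])
  let ?h = "cond_reward A \<sigma> m T" and ?h' = "cond_reward A \<sigma> m T'"
  define B where "B = {\<omega>\<in>space ?G. ?h' \<omega> \<le> ?h \<omega>}"
  have B: "B \<in> sets ?G" unfolding B_def by measurable
  have spG: "space ?G = space M" using sub by (simp add: subalgebra_def)
  have B': "space M - B \<in> sets ?G" using sets.compl_sets[OF B] spG by simp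
  have BM[measurable]: "B \<in> sets M" using B sub by (auto simp: subalgebra_def)
  define S where "S = (\<lambda>i \<omega>. (if \<omega> \<in> B then T else T') i \<omega>)"
  have cond: "{\<omega>\<in>C. R \<omega> \<le> u} \<in> sets (A u)"
    if "C \<in> sets ?G" "stopping_time A R" "\<And>\<omega>. \<omega> \<in> space M \<Longrightarrow> \<sigma> \<omega> \<le> R \<omega>" for C R u
    using filtration.sets_pre_sigmaD[OF A(1) that(2)
        subsetD[OF filtration.mono_pre_sigma[OF A(1) \<sigma> that(2,3)] that(1)]] .
  have first: "stopping_time A (R 1)" if "R \<in> strategies M m \<gamma> A \<sigma>" for R
    using strategiesD(1)[OF that, of 1] by simp
  have "(\<lambda>i \<omega>. (\<lambda>b. if b then T else T') (\<omega> \<in> B) i \<omega>) \<in> strategies M m \<gamma> A \<sigma>"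
  proof (rule strategies_paste[OF A(1), of UNIV])
    show "(if b then T else T') \<in> strategies M m \<gamma> A \<sigma>" for b using T T' by simp
    fix b :: bool and u :: ennreal
    have "{\<omega>\<in>B. T 1 \<omega> \<le> u} \<in> sets (A u)" "{\<omega>\<in>space M - B. T' 1 \<omega> \<le> u} \<in> sets (A u)"
      using cond[OF B first[OF T] strategiesD(2)[OF T]] cond[OF B' first[OF T'] strategiesD(2)[OF T']]
      by blast+
    moreover have "B \<subseteq> space M" using sets.sets_into_space[OF BM] .
    then have "{\<omega>\<in>space M. (\<omega> \<in> B) = b \<and> (if b then T else T') 1 \<omega> \<le> u} =
        (if b then {\<omega>\<in>B. T 1 \<omega> \<le> u} else {\<omega>\<in>space M - B. T' 1 \<omega> \<le> u})"
      by auto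
    ultimately show "{\<omega>\<in>space M. (\<omega> \<in> B) = b \<and> (if b then T else T') 1 \<omega> \<le> u} \<in> sets (A u)"
      by simp
  qed (use strategiesD(2)[OF T] strategiesD(2)[OF T'] in auto)
  then have S: "S \<in> strategies M m \<gamma> A \<sigma>" by (simp add: S_def)
  have meas[measurable]: "reward m R \<in> borel_measurable M" if "R \<in> strategies M m \<gamma> A \<sigma>" for R
    by (intro measurable_reward measurable_strategies[OF A that \<gamma>]) auto
  note [measurable] = meas[OF T] meas[OF T'] meas[OF S]
  have ind[measurable]: "(indicator B :: 'a \<Rightarrow> ennreal) \<in> borel_measurable ?G"
      "(indicator (space M - B) :: 'a \<Rightarrow> ennreal) \<in> borel_measurable ?G"
    using B B' by auto
  have "AE \<omega> in M. indicator B \<omega> * ?h \<omega> = nn_cond_exp M ?G (\<lambda>\<omega>. indicator B \<omega> * reward m T \<omega>) \<omega>"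
    by (intro G.nn_cond_exp_prod) measurable
  moreover have "AE \<omega> in M. indicator (space M - B) \<omega> * ?h' \<omega> =
      nn_cond_exp M ?G (\<lambda>\<omega>. indicator (space M - B) \<omega> * reward m T' \<omega>) \<omega>"
    by (intro G.nn_cond_exp_prod) measurable
  moreover have "AE \<omega> in M. nn_cond_exp M ?G (\<lambda>\<omega>. indicator B \<omega> * reward m T \<omega>) \<omega> +
      nn_cond_exp M ?G (\<lambda>\<omega>. indicator (space M - B) \<omega> * reward m T' \<omega>) \<omega> =
      nn_cond_exp M ?G (\<lambda>\<omega>. indicator B \<omega> * reward m T \<omega> + indicator (space M - B) \<omega> * reward m T' \<omega>) \<omega>"
    by (intro G.nn_cond_exp_sum) measurable
  moreover have "AE \<omega> in M. nn_cond_exp M ?G (\<lambda>\<omega>. indicator B \<omega> * reward m T \<omega> + indicator (space M - B) \<omega> * reward m T' \<omega>) \<omega>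
      = cond_reward A \<sigma> m S \<omega>"
  proof (rule G.nn_cond_exp_cong[OF AE_I2])
    show "indicator B \<omega> * reward m T \<omega> + indicator (space M - B) \<omega> * reward m T' \<omega> = reward m S \<omega>"
      if "\<omega> \<in> space M" for \<omega>
      using that by (auto simp: S_def split: split_indicator)
  qed measurable
  moreover have "AE \<omega> in M. \<omega> \<in> space M" by (rule AE_space)
  ultimately have "AE \<omega> in M. max (?h \<omega>) (?h' \<omega>) \<le> cond_reward A \<sigma> m S \<omega>"
  proof eventually_elim
    case (elim \<omega>)
    have "max (?h \<omega>) (?h' \<omega>) = indicator B \<omega> * ?h \<omega> + indicator (space M - B) \<omega> * ?h' \<omega>"
      using elim(5) spG by (auto simp: B_def max_def split: split_indicator)
    then show ?case using elim by simp
  qed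
  with S show ?thesis by blast
qed

lemma Zval_sequence:
  assumes A: "filtration (space M) A" "\<And>t. sets (A t) \<subseteq> sets M" and \<sigma>: "stopping_time A \<sigma>"
    and \<gamma>: "\<And>i. i \<in> {1..<m} \<Longrightarrow> \<gamma> i \<in> borel_measurable M" and m: "m \<ge> 1"
  obtains T where "\<And>k::nat. T k \<in> strategies M m \<gamma> A \<sigma>"
    "\<And>k. AE \<omega> in M. cond_reward A \<sigma> m (T k) \<omega> \<le> cond_reward A \<sigma> m (T (Suc k)) \<omega>"
    "AE \<omega> in M. Zval M Y m \<gamma> A \<sigma> \<omega> = (SUP k. cond_reward A \<sigma> m (T k) \<omega>)"
proof -
  let ?\<Phi> = "cond_reward A \<sigma> m ` strategies M m \<gamma> A \<sigma>"
  have Z: "is_family_esssup M ?\<Phi> (Zval M Y m \<gamma> A \<sigma>)"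
    using m is_family_esssup_value_over by (simp add: Zval_def)
  have \<Phi>: "?\<Phi> \<subseteq> borel_measurable M" "?\<Phi> \<noteq> {}"
    using const_top_in_strategies[of M m \<gamma> A \<sigma>] by auto
  have dir: "\<exists>W\<in>?\<Phi>. AE \<omega> in M. max (X \<omega>) (X' \<omega>) \<le> W \<omega>" if "X \<in> ?\<Phi>" "X' \<in> ?\<Phi>" for X X'
  proof -
    obtain T T' where T: "T \<in> strategies M m \<gamma> A \<sigma>" "X = cond_reward A \<sigma> m T"
      and T': "T' \<in> strategies M m \<gamma> A \<sigma>" "X' = cond_reward A \<sigma> m T'"
      using \<open>X \<in> ?\<Phi>\<close> \<open>X' \<in> ?\<Phi>\<close> by blast
    obtain S where "S \<in> strategies M m \<gamma> A \<sigma>"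
        "AE \<omega> in M. max (X \<omega>) (X' \<omega>) \<le> cond_reward A \<sigma> m S \<omega>"
      using cond_reward_directed[of A \<sigma> m \<gamma> T T', OF A \<sigma> _ T(1) T'(1)] \<gamma> T(2) T'(2) by auto
    then show ?thesis by blast
  qed
  have "\<exists>X::nat \<Rightarrow> 'a \<Rightarrow> ennreal. (\<forall>k. X k \<in> ?\<Phi>) \<and> (\<forall>k. AE \<omega> in M. X k \<omega> \<le> X (Suc k) \<omega>) \<and>
      (AE \<omega> in M. Zval M Y m \<gamma> A \<sigma> \<omega> = (SUP k. X k \<omega>))"
  proof (rule directed_family_esssup_sequence[OF \<Phi> _ Z])
    show "\<exists>W\<in>?\<Phi>. AE \<omega> in M. max (X \<omega>) (X' \<omega>) \<le> W \<omega>" if "X \<in> ?\<Phi>" "X' \<in> ?\<Phi>" for X X'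
      by (rule dir[OF that])
  qed (intro exI conjI allI; assumption)
  then obtain X where X: "\<forall>k. X k \<in> ?\<Phi>" "\<forall>k. AE \<omega> in M. X k \<omega> \<le> X (Suc k) \<omega>"
      "AE \<omega> in M. Zval M Y m \<gamma> A \<sigma> \<omega> = (SUP k::nat. X k \<omega>)" by (elim exE conjE)
  from X(1) have "\<forall>k. \<exists>T. T \<in> strategies M m \<gamma> A \<sigma> \<and> X k = cond_reward A \<sigma> m T" by blast
  then obtain T where "\<And>k. T k \<in> strategies M m \<gamma> A \<sigma>" "\<And>k. X k = cond_reward A \<sigma> m (T k)"
    unfolding choice_iff by blast
  with X show thesis by (intro that[of T]) simp_all
qed

lemma sets_F_subset_enlarge: "sets (F t) \<subseteq> sets (enlarge M F \<rho> t)"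
proof (cases "t < \<infinity>")
  case True
  then show ?thesis by (intro sets_subset_enlarge filtration_F)
next
  case False
  then have t: "t = \<top>" by (simp add: not_less top_unique)
  have "(\<Union>s\<in>{..<\<infinity>}. sets (F s)) \<subseteq> sets (enlarge M F \<rho> \<top>)"
    using sets_subset_adjoin_time[OF filtration_F]
    by (auto simp: sets_enlarge_top intro!: sigma_sets.Basic)
  then have "sigma_sets (space (enlarge M F \<rho> \<top>)) (\<Union>s\<in>{..<\<infinity>}. sets (F s)) \<subseteq> sets (enlarge M F \<rho> \<top>)"
    by (rule sets.sigma_sets_subset)
  then show ?thesis using sets_F_infinity by (simp add: t)
qed

text \<open>Events known at \<open>t\<close> thus remain valid test sets for conditioning at
  \<open>\<rho>\<close> in the enlarged filtration. For \<open>u < t\<close> there is nothing to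
  check, since \<open>\<rho> \<omega> \<le> u\<close> is impossible.\<close>

lemma sets_F_subset_pre_sigma_enlarge:
  assumes "\<And>\<omega>. \<omega> \<in> space M \<Longrightarrow> t \<le> \<rho> \<omega>" and B: "B \<in> sets (F t)"
  shows "B \<in> sets (filtration.pre_sigma (space M) (enlarge M F \<rho>) \<rho>)"
proof (rule filtration.sets_pre_sigmaI[OF filtration_enlarge[OF filtration_F] stopping_time_enlarge[OF filtration_F]])
  fix u
  have sub: "B \<subseteq> space M" using sets.sets_into_space[OF B] by (simp add: space_F)
  show "{\<omega>\<in>B. \<rho> \<omega> \<le> u} \<in> sets (enlarge M F \<rho> u)"
  proof (cases "t \<le> u")
    case True
    have "B \<in> sets (enlarge M F \<rho> u)"
      using B sets_F_subset_enlarge[of t \<rho>] filtration.sets_F_mono[OF filtration_enlarge[OF filtration_F] True] by blast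
    moreover have "{\<omega>\<in>space M. \<rho> \<omega> \<le> u} \<in> sets (enlarge M F \<rho> u)"
      using stopping_timeD[OF stopping_time_enlarge[OF filtration_F], of \<rho> u] by (simp add: pred_def)
    ultimately have "B \<inter> {\<omega>\<in>space M. \<rho> \<omega> \<le> u} \<in> sets (enlarge M F \<rho> u)" by blast
    also have "B \<inter> {\<omega>\<in>space M. \<rho> \<omega> \<le> u} = {\<omega>\<in>B. \<rho> \<omega> \<le> u}" using sub by auto
    finally show ?thesis .
  next
    case False
    then have "\<not> \<rho> \<omega> \<le> u" if "\<omega> \<in> B" for \<omega>
      using that sub assms(1)[of \<omega>] by (meson order_trans subsetD)
    then have "{\<omega>\<in>B. \<rho> \<omega> \<le> u} = {}" by blast
    then show ?thesis by (simp only: sets.empty_sets)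
  qed
qed

lemma measurable_Zval: "Zval M Y m \<gamma> A \<sigma> \<in> borel_measurable M"
  using is_family_esssup_value_over[of A \<sigma> m "strategies M m \<gamma> A \<sigma>"]
  by (auto simp: Zval_def is_family_esssup_def)

lemma set_nn_integral_Zbar:
  assumes "B \<in> sets (F t)"
  shows "(\<integral>\<^sup>+\<omega>\<in>B. Zbar M F Y m \<delta> t \<omega> \<partial>M) =
    (\<integral>\<^sup>+\<omega>\<in>B. Zval M Y m (\<lambda>i. \<delta> (Suc i)) (enlarge M F (\<lambda>\<omega>. t + \<delta> 1 \<omega>)) (\<lambda>\<omega>. t + \<delta> 1 \<omega>) \<omega> \<partial>M)"
  unfolding Zbar_def
  by (rule sigma_finite_subalgebra.nn_cond_exp_set_nn_integral[OF
        sigma_finite_subalgebraI[OF subalgebra_F] assms measurable_Zval])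

text \<open>Strategies for the enlarged filtration at \<open>t + \<delta> 1\<close> are the tails of the strategies for \<open>F\<close>
  whose first exercise time is the constant \<open>t\<close>.\<close>

lemma set_nn_integral_tail_le_Zbar:
  assumes T: "T \<in> strategies M (Suc m) \<delta> F \<sigma>" and T1: "T 1 = (\<lambda>_. t)"
    and \<delta>: "\<And>i. i \<in> {1..m} \<Longrightarrow> \<delta> i \<in> borel_measurable M"
    and B: "B \<in> sets (F t)"
  shows "(\<integral>\<^sup>+\<omega>\<in>B. reward m (\<lambda>i. T (Suc i)) \<omega> \<partial>M) \<le> (\<integral>\<^sup>+\<omega>\<in>B. Zbar M F Y m \<delta> t \<omega> \<partial>M)"
proof (cases "m = 0")
  case False
  then have m: "m \<ge> 1" by simp
  define \<rho> where "\<rho> = (\<lambda>\<omega>. t + \<delta> 1 \<omega>)"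
  let ?A = "enlarge M F \<rho>" and ?\<gamma> = "\<lambda>i. \<delta> (Suc i)"
  have [measurable]: "\<delta> 1 \<in> borel_measurable M" using \<delta> m by simp
  then have A: "filtration (space M) ?A" "\<And>t. sets (?A t) \<subseteq> sets M" "stopping_time ?A \<rho>"
    by (auto intro!: filtration_enlarge[OF filtration_F] sets_enlarge_subset[OF filtration_F sets_F_subset]
        stopping_time_enlarge[OF filtration_F] simp: \<rho>_def)
  have \<gamma>: "?\<gamma> i \<in> borel_measurable M" if "i \<in> {1..<m}" for i using that \<delta> by auto
  let ?T = "\<lambda>i. T (Suc i)"
  have S: "?T \<in> strategies M m ?\<gamma> ?A \<rho>"
    using T T1 by (simp add: strategies_Suc_iff[OF m] \<rho>_def)
  have meas: "reward m ?T \<in> borel_measurable M"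
    by (intro measurable_reward measurable_strategies[OF A(1,2) S \<gamma>]) auto
  let ?G = "filtration.pre_sigma (space M) ?A \<rho>"
  have BG: "B \<in> sets ?G"
    by (rule sets_F_subset_pre_sigma_enlarge[OF _ B]) (simp add: \<rho>_def)
  have "(\<integral>\<^sup>+\<omega>\<in>B. reward m ?T \<omega> \<partial>M) = (\<integral>\<^sup>+\<omega>\<in>B. cond_reward ?A \<rho> m ?T \<omega> \<partial>M)"
    by (rule sigma_finite_subalgebra.nn_cond_exp_set_nn_integral[OF
        sigma_finite_subalgebraI[OF subalgebra_pre_sigma[OF A]] BG meas, symmetric])
  also have "\<dots> \<le> (\<integral>\<^sup>+\<omega>\<in>B. Zval M Y m ?\<gamma> ?A \<rho> \<omega> \<partial>M)"
  proof (rule nn_integral_mono_AE)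
    have "AE \<omega> in M. cond_reward ?A \<rho> m ?T \<omega> \<le> Zval M Y m ?\<gamma> ?A \<rho> \<omega>"
      using is_family_esssup_value_over[of ?A \<rho> m "strategies M m ?\<gamma> ?A \<rho>"] S m
      by (simp add: Zval_def is_family_esssup_def)
    then show "AE \<omega> in M. cond_reward ?A \<rho> m ?T \<omega> * indicator B \<omega> \<le> Zval M Y m ?\<gamma> ?A \<rho> \<omega> * indicator B \<omega>"
      by eventually_elim (rule mult_right_mono, auto)
  qed
  finally show ?thesis by (simp add: set_nn_integral_Zbar[OF B] \<rho>_def)
qed simp

text \<open>Only the conditional rewards increase along the sequence, and only almost surely; the
  rewards themselves need not. Integrals over events in \<open>F t\<close> do not see the
  difference, so monotonicity is recorded for them. It is needed to exchange the supremum over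
  \<open>k\<close> with a sum over the values of a stopping time.\<close>

lemma Zbar_sequence:
  assumes \<delta>: "\<And>i. i \<in> {1..m} \<Longrightarrow> \<delta> i \<in> borel_measurable M"
  obtains T where "\<And>k::nat. T k \<in> strategies M (Suc m) \<delta> F (\<lambda>_. t)" "\<And>k. T k 1 = (\<lambda>_. t)"
    "\<And>B. B \<in> sets (F t) \<Longrightarrow> incseq (\<lambda>k. \<integral>\<^sup>+\<omega>\<in>B. reward m (\<lambda>i. T k (Suc i)) \<omega> \<partial>M)"
    "\<And>B. B \<in> sets (F t) \<Longrightarrow> (\<integral>\<^sup>+\<omega>\<in>B. Zbar M F Y m \<delta> t \<omega> \<partial>M) =
      (SUP k. \<integral>\<^sup>+\<omega>\<in>B. reward m (\<lambda>i. T k (Suc i)) \<omega> \<partial>M)"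
proof (cases "m = 0")
  case True
  \<comment> \<open>With no exercise left after the first, both sides vanish and any strategy
    starting at \<open>t\<close> will do.\<close>
  let ?T = "\<lambda>(k::nat) i (\<omega>::'a). if i = (1::nat) then t else \<top>"
  have "stopping_time F (\<lambda>_::'a. t)" by (rule stopping_time_const)
  then have "?T k \<in> strategies M (Suc m) \<delta> F (\<lambda>_. t)" for k
    using True by (intro strategiesI) auto
  moreover have "(\<integral>\<^sup>+\<omega>\<in>B. Zbar M F Y m \<delta> t \<omega> \<partial>M) = 0" if "B \<in> sets (F t)" for B
    using True by (simp add: set_nn_integral_Zbar[OF that] Zval_def)
  ultimately show thesis using True by (intro that[of ?T]) auto
next
  case False
  then have m: "m \<ge> 1" by simp
  define \<rho> where "\<rho> = (\<lambda>\<omega>. t + \<delta> 1 \<omega>)"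
  let ?A = "enlarge M F \<rho>" and ?\<gamma> = "\<lambda>i. \<delta> (Suc i)"
  have [measurable]: "\<delta> 1 \<in> borel_measurable M" using \<delta> m by simp
  then have A: "filtration (space M) ?A" "\<And>t. sets (?A t) \<subseteq> sets M" "stopping_time ?A \<rho>"
    by (auto intro!: filtration_enlarge[OF filtration_F] sets_enlarge_subset[OF filtration_F sets_F_subset]
        stopping_time_enlarge[OF filtration_F] simp: \<rho>_def)
  have \<gamma>: "?\<gamma> i \<in> borel_measurable M" if "i \<in> {1..<m}" for i using that \<delta> by auto
  obtain S where S: "\<And>k::nat. S k \<in> strategies M m ?\<gamma> ?A \<rho>"
    "\<And>k. AE \<omega> in M. cond_reward ?A \<rho> m (S k) \<omega> \<le> cond_reward ?A \<rho> m (S (Suc k)) \<omega>"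
    "AE \<omega> in M. Zval M Y m ?\<gamma> ?A \<rho> \<omega> = (SUP k. cond_reward ?A \<rho> m (S k) \<omega>)"
    by (rule Zval_sequence[of ?A \<rho> m ?\<gamma>]) (use A \<gamma> m in auto)
  have meas: "reward m (S k) \<in> borel_measurable M" for k
    by (intro measurable_reward measurable_strategies[OF A(1,2) S(1) \<gamma>]) auto
  let ?G = "filtration.pre_sigma (space M) ?A \<rho>"
  have int_eq: "(\<integral>\<^sup>+\<omega>\<in>B. cond_reward ?A \<rho> m (S k) \<omega> \<partial>M) = (\<integral>\<^sup>+\<omega>\<in>B. reward m (S k) \<omega> \<partial>M)"
    if B: "B \<in> sets (F t)" for B k
  proof (rule sigma_finite_subalgebra.nn_cond_exp_set_nn_integral[OF
        sigma_finite_subalgebraI[OF subalgebra_pre_sigma[OF A]] _ meas])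
    show "B \<in> sets ?G" by (rule sets_F_subset_pre_sigma_enlarge[OF _ B]) (simp add: \<rho>_def)
  qed
  \<comment> \<open>Position 1 holds the constant \<open>t\<close>, and position
    \<open>i + 1\<close> holds \<open>S k i\<close> for \<open>i \<ge> 1\<close>; the free entry 0
    of \<open>S k\<close> is overwritten for this purpose.\<close>
  define T where "T k i = ((S k)(0 := (\<lambda>_. t))) (i - 1)" for k i
  have T_Suc: "(\<lambda>i. T k (Suc i)) = (S k)(0 := (\<lambda>_. t))" for k by (auto simp: T_def)
  have T1: "T k 1 = (\<lambda>_. t)" for k by (simp add: T_def)
  have T_reward: "reward m (\<lambda>i. T k (Suc i)) \<omega> = reward m (S k) \<omega>" for k \<omega>
    by (auto simp: T_def intro!: sum.cong)
  show thesis
  proof (rule that)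
    show "T k \<in> strategies M (Suc m) \<delta> F (\<lambda>_. t)" for k
      unfolding strategies_Suc_iff[OF m] T1 T_Suc
      using strategies_fun_upd_0[OF S(1)] by (auto simp: stopping_times_from_def stopping_time_const \<rho>_def)
    show "T k 1 = (\<lambda>_. t)" for k by (rule T1)
    fix B assume B: "B \<in> sets (F t)"
    then have [measurable]: "B \<in> sets M" using sets_F_subset by blast
    have inc: "AE \<omega> in M. \<forall>k. cond_reward ?A \<rho> m (S k) \<omega> * indicator B \<omega> \<le> cond_reward ?A \<rho> m (S (Suc k)) \<omega> * indicator B \<omega>"
      unfolding AE_all_countable
    proof
      show "AE \<omega> in M. cond_reward ?A \<rho> m (S k) \<omega> * indicator B \<omega> \<le> cond_reward ?A \<rho> m (S (Suc k)) \<omega> * indicator B \<omega>" for k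
        using S(2)[of k] by eventually_elim (rule mult_right_mono, auto)
    qed
    show "incseq (\<lambda>k. \<integral>\<^sup>+\<omega>\<in>B. reward m (\<lambda>i. T k (Suc i)) \<omega> \<partial>M)"
      unfolding T_reward int_eq[OF B, symmetric]
      by (intro incseq_SucI nn_integral_mono_AE) (rule eventually_mono[OF inc], blast)
    have "(\<integral>\<^sup>+\<omega>\<in>B. Zbar M F Y m \<delta> t \<omega> \<partial>M) = (\<integral>\<^sup>+\<omega>\<in>B. Zval M Y m ?\<gamma> ?A \<rho> \<omega> \<partial>M)"
      by (simp add: set_nn_integral_Zbar[OF B] \<rho>_def)
    also have "\<dots> = (\<integral>\<^sup>+\<omega>. (SUP k. cond_reward ?A \<rho> m (S k) \<omega> * indicator B \<omega>) \<partial>M)"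
      using S(3) by (intro nn_integral_cong_AE) (erule eventually_mono, simp add: SUP_mult_right_ennreal)
    also have "\<dots> = (SUP k. \<integral>\<^sup>+\<omega>\<in>B. cond_reward ?A \<rho> m (S k) \<omega> \<partial>M)"
      using inc by (intro nn_integral_monotone_convergence_SUP_AE) (auto simp: AE_all_countable)
    finally show "(\<integral>\<^sup>+\<omega>\<in>B. Zbar M F Y m \<delta> t \<omega> \<partial>M) = (SUP k. \<integral>\<^sup>+\<omega>\<in>B. reward m (\<lambda>i. T k (Suc i)) \<omega> \<partial>M)"
      by (simp only: int_eq[OF B] T_reward)
  qed
qed

end

section \<open>Reduction to optimal stopping of \<open>Y + Zr\<close>\<close>

locale continuation_process = reward_process M F Y
  for M :: "'a measure" and F :: "ennreal \<Rightarrow> 'a measure" and Y :: "ennreal \<Rightarrow> 'a \<Rightarrow> ennreal" +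
  fixes m :: nat and \<delta> :: "nat \<Rightarrow> 'a \<Rightarrow> ennreal" and Zr :: "ennreal \<Rightarrow> 'a \<Rightarrow> ennreal"
  assumes measurable_\<delta>: "i \<in> {1..m} \<Longrightarrow> \<delta> i \<in> borel_measurable M"
    and Zr: "right_continuous_modification M (Zbar M F Y m \<delta>) Zr"
begin

lemma measurable_Zr: "Zr t \<in> borel_measurable M"
  and right_continuous_Zr: "right_continuous_paths M Zr"
  and AE_Zr: "AE \<omega> in M. Zr t \<omega> = Zbar M F Y m \<delta> t \<omega>"
  using Zr by (auto simp: right_continuous_modification_def)

lemma set_nn_integral_Zr: "(\<integral>\<^sup>+\<omega>\<in>B. Zr t \<omega> \<partial>M) = (\<integral>\<^sup>+\<omega>\<in>B. Zbar M F Y m \<delta> t \<omega> \<partial>M)"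
  using AE_Zr[of t] by (intro nn_integral_cong_AE) (erule eventually_mono, simp)

lemma measurable_at_stopping_time:
  assumes "stopping_time F \<tau>"
  shows "\<tau> \<in> borel_measurable M" "(\<lambda>\<omega>. Y (\<tau> \<omega>) \<omega>) \<in> borel_measurable M"
    "(\<lambda>\<omega>. Zr (\<tau> \<omega>) \<omega>) \<in> borel_measurable M"
proof -
  show \<tau>: "\<tau> \<in> borel_measurable M"
    using space_F by (intro measurable_stopping_time[OF assms sets_F_subset]) auto
  show "(\<lambda>\<omega>. Y (\<tau> \<omega>) \<omega>) \<in> borel_measurable M" "(\<lambda>\<omega>. Zr (\<tau> \<omega>) \<omega>) \<in> borel_measurable M"
    by (rule measurable_process_at_time[OF measurable_Y right_continuous_Y \<tau>]
        measurable_process_at_time[OF measurable_Zr right_continuous_Zr \<tau>])+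
qed

lemma set_nn_integral_partition:
  assumes \<sigma>: "stopping_time F \<sigma>" and \<tau>: "stopping_time F \<tau>" "\<And>\<omega>. \<omega> \<in> space M \<Longrightarrow> \<sigma> \<omega> \<le> \<tau> \<omega>"
    and R: "countable (\<tau> ` space M)" and B: "B \<in> sets (pre_sigma \<sigma>)"
    and f: "f \<in> borel_measurable M"
  shows "(\<integral>\<^sup>+\<omega>\<in>B. f \<omega> \<partial>M) =
    (\<integral>\<^sup>+t. (\<integral>\<^sup>+\<omega>\<in>B \<inter> {\<omega>\<in>space M. \<tau> \<omega> = t}. f \<omega> \<partial>M) \<partial>count_space (\<tau> ` space M))"
proof -
  have "{\<omega>\<in>space M. \<tau> \<omega> = t} \<in> sets M" for t
    using measurable_sets[OF measurable_at_stopping_time(1)[OF \<tau>(1)], of "{t}"]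
    by (simp add: vimage_def Int_def conj_commute)
  moreover have [measurable]: "B \<in> sets M"
    using B subalgebra_pre_sigma[OF filtration_F sets_F_subset \<sigma>] by (auto simp: subalgebra_def)
  then have "(\<lambda>\<omega>. f \<omega> * indicator B \<omega>) \<in> borel_measurable M" using f by measurable
  ultimately have "(\<integral>\<^sup>+\<omega>\<in>B. f \<omega> \<partial>M) = (\<integral>\<^sup>+t. (\<integral>\<^sup>+\<omega>. f \<omega> * indicator B \<omega> *
      indicator {\<omega>\<in>space M. \<tau> \<omega> = t} \<omega> \<partial>M) \<partial>count_space (\<tau> ` space M))"
    by (intro nn_integral_countable_partition R) auto
  also have "\<dots> = (\<integral>\<^sup>+t. (\<integral>\<^sup>+\<omega>\<in>B \<inter> {\<omega>\<in>space M. \<tau> \<omega> = t}. f \<omega> \<partial>M) \<partial>count_space (\<tau> ` space M))"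
    by (intro nn_integral_cong) (auto split: split_indicator)
  finally show ?thesis .
qed

text \<open>For each value \<open>t\<close> the tail of \<open>T\<close> is compared with the
  continuation value on the event \<open>T 1 \<omega> = t\<close>, and the results are summed. The
  comparison needs a strategy whose first time is \<open>t\<close> everywhere, so \<open>T\<close>
  is altered off this event.\<close>

lemma set_nn_integral_reward_le:
  assumes \<sigma>: "stopping_time F \<sigma>" and T: "T \<in> strategies_disc M (Suc m) \<delta> F \<sigma>"
    and B: "B \<in> sets (pre_sigma \<sigma>)"
  shows "(\<integral>\<^sup>+\<omega>\<in>B. reward (Suc m) T \<omega> \<partial>M) \<le> (\<integral>\<^sup>+\<omega>\<in>B. Y (T 1 \<omega>) \<omega> + Zr (T 1 \<omega>) \<omega> \<partial>M)"
proof -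
  have S: "T \<in> strategies M (Suc m) \<delta> F \<sigma>" and R: "countable (T 1 ` space M)"
    using T by (auto simp: strategies_disc_def)
  have T1: "stopping_time F (T 1)" "\<And>\<omega>. \<omega> \<in> space M \<Longrightarrow> \<sigma> \<omega> \<le> T 1 \<omega>"
    using strategiesD(1)[OF S, of 1] strategiesD(2)[OF S] by auto
  let ?C = "\<lambda>t. B \<inter> {\<omega>\<in>space M. T 1 \<omega> = t}"
  have C: "?C t \<in> sets (F t)" for t
    by (rule Int_eq_const_in_sets[OF \<sigma> T1 B])
  have meas: "reward m (\<lambda>i. T (Suc i)) \<in> borel_measurable M"
    by (intro measurable_reward measurable_strategies[OF filtration_F sets_F_subset S measurable_\<delta>]) auto
  have [measurable]: "B \<in> sets M"
    using B subalgebra_pre_sigma[OF filtration_F sets_F_subset \<sigma>] by (auto simp: subalgebra_def)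
  note [measurable] = measurable_at_stopping_time[OF T1(1)]
  have *: "(\<integral>\<^sup>+\<omega>\<in>?C t. reward m (\<lambda>i. T (Suc i)) \<omega> \<partial>M) \<le> (\<integral>\<^sup>+\<omega>\<in>?C t. Zr (T 1 \<omega>) \<omega> \<partial>M)" for t
  proof -
    \<comment> \<open>The substitute exercises at \<open>t\<close> and puts everything else at
      \<infinity>, which meets every waiting constraint.\<close>
    define U :: "bool \<Rightarrow> nat \<Rightarrow> 'a \<Rightarrow> ennreal"
      where "U b = (if b then T else (\<lambda>i _. if i = 1 then t else \<top>))" for b
    define V where "V = (\<lambda>i \<omega>. U (T 1 \<omega> = t) i \<omega>)"
    have "V \<in> strategies M (Suc m) \<delta> F (\<lambda>_. t)"
      unfolding V_def
    proof (rule strategies_paste[OF filtration_F, of UNIV])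
      \<comment> \<open>Each piece has its own lower bound: \<open>T\<close> may start before
        \<open>t\<close> off the event, so only 0 is claimed for it.\<close>
      show "U b \<in> strategies M (Suc m) \<delta> F (\<lambda>_. if b then 0 else t)" for b
      proof (cases b)
        case True
        with S show ?thesis by (auto simp: U_def strategies_iff)
      next
        case False
        have "(\<lambda>i _. if i = 1 then t else \<top>) \<in> strategies M (Suc m) \<delta> F (\<lambda>_. t)"
          by (rule strategiesI) (auto simp: stopping_time_const)
        with False show ?thesis by (simp add: U_def)
      qed
      fix b :: bool and u :: ennreal
      have eq: "{\<omega>\<in>space M. T 1 \<omega> = t} \<in> sets (F t)"
        using stopping_time_eq_const[OF T1(1), of t] by (simp add: pred_def space_F)
      show "{\<omega>\<in>space M. (T 1 \<omega> = t) = b \<and> U b 1 \<omega> \<le> u} \<in> sets (F u)"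
      \<comment> \<open>Whether \<open>T 1 \<omega> = t\<close> is known from time \<open>t\<close>
        on; before \<open>t\<close>, neither piece has made an exercise on its own event.\<close>
      proof (cases "t \<le> u")
        case True
        then have "{\<omega>\<in>space M. T 1 \<omega> = t} \<in> sets (F u)" using eq sets_F_mono by blast
        moreover from this have "space M - {\<omega>\<in>space M. T 1 \<omega> = t} \<in> sets (F u)"
          using sets.compl_sets[of _ "F u"] by (simp add: space_F)
        moreover have "{\<omega>\<in>space M. (T 1 \<omega> = t) = b \<and> U b 1 \<omega> \<le> u} =
            (if b then {\<omega>\<in>space M. T 1 \<omega> = t} else space M - {\<omega>\<in>space M. T 1 \<omega> = t})"
          using True by (auto simp: U_def)
        ultimately show ?thesis by simp
      next
        case False
        then have "{\<omega>\<in>space M. (T 1 \<omega> = t) = b \<and> U b 1 \<omega> \<le> u} = {}" by (auto simp: U_def)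
        then show ?thesis by (simp only: sets.empty_sets)
      qed
    qed (auto simp: U_def)
    moreover have "V 1 = (\<lambda>_. t)" by (auto simp: V_def U_def)
    ultimately have "(\<integral>\<^sup>+\<omega>\<in>?C t. reward m (\<lambda>i. V (Suc i)) \<omega> \<partial>M) \<le> (\<integral>\<^sup>+\<omega>\<in>?C t. Zbar M F Y m \<delta> t \<omega> \<partial>M)"
      by (rule set_nn_integral_tail_le_Zbar) (rule measurable_\<delta>, assumption, rule C)
    also have "\<dots> = (\<integral>\<^sup>+\<omega>\<in>?C t. Zr t \<omega> \<partial>M)" by (rule set_nn_integral_Zr[symmetric])
    also have "\<dots> = (\<integral>\<^sup>+\<omega>\<in>?C t. Zr (T 1 \<omega>) \<omega> \<partial>M)"
      by (intro nn_integral_cong) (auto split: split_indicator)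
    also have "(\<integral>\<^sup>+\<omega>\<in>?C t. reward m (\<lambda>i. V (Suc i)) \<omega> \<partial>M) = (\<integral>\<^sup>+\<omega>\<in>?C t. reward m (\<lambda>i. T (Suc i)) \<omega> \<partial>M)"
      by (intro nn_integral_cong) (auto simp: V_def U_def split: split_indicator)
    finally show ?thesis .
  qed
  have "(\<integral>\<^sup>+\<omega>\<in>B. reward m (\<lambda>i. T (Suc i)) \<omega> \<partial>M) =
      (\<integral>\<^sup>+t. (\<integral>\<^sup>+\<omega>\<in>?C t. reward m (\<lambda>i. T (Suc i)) \<omega> \<partial>M) \<partial>count_space (T 1 ` space M))"
    by (rule set_nn_integral_partition[OF \<sigma> T1 R B meas])
  also have "\<dots> \<le> (\<integral>\<^sup>+t. (\<integral>\<^sup>+\<omega>\<in>?C t. Zr (T 1 \<omega>) \<omega> \<partial>M) \<partial>count_space (T 1 ` space M))"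
    by (rule nn_integral_mono) (rule *)
  also have "\<dots> = (\<integral>\<^sup>+\<omega>\<in>B. Zr (T 1 \<omega>) \<omega> \<partial>M)"
    by (rule set_nn_integral_partition[OF \<sigma> T1 R B measurable_at_stopping_time(3)[OF T1(1)], symmetric])
  finally have tail: "(\<integral>\<^sup>+\<omega>\<in>B. reward m (\<lambda>i. T (Suc i)) \<omega> \<partial>M) \<le> (\<integral>\<^sup>+\<omega>\<in>B. Zr (T 1 \<omega>) \<omega> \<partial>M)" .
  have "(\<integral>\<^sup>+\<omega>\<in>B. reward (Suc m) T \<omega> \<partial>M) =
      (\<integral>\<^sup>+\<omega>\<in>B. Y (T 1 \<omega>) \<omega> \<partial>M) + (\<integral>\<^sup>+\<omega>\<in>B. reward m (\<lambda>i. T (Suc i)) \<omega> \<partial>M)"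
    unfolding reward_Suc by (intro nn_set_integral_add meas) measurable
  also have "(\<integral>\<^sup>+\<omega>\<in>B. reward m (\<lambda>i. T (Suc i)) \<omega> \<partial>M) \<le> (\<integral>\<^sup>+\<omega>\<in>B. Zr (T 1 \<omega>) \<omega> \<partial>M)"
    by (rule tail)
  also have "(\<integral>\<^sup>+\<omega>\<in>B. Y (T 1 \<omega>) \<omega> \<partial>M) + (\<integral>\<^sup>+\<omega>\<in>B. Zr (T 1 \<omega>) \<omega> \<partial>M) =
      (\<integral>\<^sup>+\<omega>\<in>B. Y (T 1 \<omega>) \<omega> + Zr (T 1 \<omega>) \<omega> \<partial>M)"
    by (intro nn_set_integral_add[symmetric]) measurable
  finally show ?thesis by (simp add: add_left_mono)
qed

text \<open>Near-optimal tails are chosen for every value \<open>t\<close>, and those with the same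
  index \<open>k\<close> are glued along the events \<open>\<tau> \<omega> = t\<close>. The first
  time of \<open>T k\<close> is then \<open>\<tau>\<close> for every \<open>k\<close>; only the tail
  improves.\<close>

lemma ex_strategies_disc_approx:
  assumes \<sigma>: "stopping_time F \<sigma>" and \<tau>: "stopping_time F \<tau>" "\<And>\<omega>. \<omega> \<in> space M \<Longrightarrow> \<sigma> \<omega> \<le> \<tau> \<omega>"
    and R: "countable (\<tau> ` space M)"
  obtains T where "\<And>k::nat. T k \<in> strategies_disc M (Suc m) \<delta> F \<sigma>"
    "\<And>B. B \<in> sets (pre_sigma \<sigma>) \<Longrightarrow>
      (\<integral>\<^sup>+\<omega>\<in>B. Y (\<tau> \<omega>) \<omega> + Zr (\<tau> \<omega>) \<omega> \<partial>M) \<le> (SUP k. \<integral>\<^sup>+\<omega>\<in>B. reward (Suc m) (T k) \<omega> \<partial>M)"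
proof -
  let ?P = "\<lambda>t (T :: nat \<Rightarrow> nat \<Rightarrow> 'a \<Rightarrow> ennreal). (\<forall>k. T k \<in> strategies M (Suc m) \<delta> F (\<lambda>_. t)) \<and> (\<forall>k. T k 1 = (\<lambda>_. t)) \<and>
      (\<forall>B\<in>sets (F t). incseq (\<lambda>k. \<integral>\<^sup>+\<omega>\<in>B. reward m (\<lambda>i. T k (Suc i)) \<omega> \<partial>M)) \<and>
      (\<forall>B\<in>sets (F t). (\<integral>\<^sup>+\<omega>\<in>B. Zbar M F Y m \<delta> t \<omega> \<partial>M) =
      (SUP k. \<integral>\<^sup>+\<omega>\<in>B. reward m (\<lambda>i. T k (Suc i)) \<omega> \<partial>M))"
  have "\<exists>T. ?P t T" for t
  proof (rule Zbar_sequence[where m=m and \<delta>=\<delta> and t=t])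
    show "\<delta> i \<in> borel_measurable M" if "i \<in> {1..m}" for i by (rule measurable_\<delta>[OF that])
  next
    fix T :: "nat \<Rightarrow> nat \<Rightarrow> 'a \<Rightarrow> ennreal"
    assume T: "\<And>k. T k \<in> strategies M (Suc m) \<delta> F (\<lambda>_. t)" "\<And>k. T k 1 = (\<lambda>_. t)"
      "\<And>B. B \<in> sets (F t) \<Longrightarrow> incseq (\<lambda>k. \<integral>\<^sup>+\<omega>\<in>B. reward m (\<lambda>i. T k (Suc i)) \<omega> \<partial>M)"
      "\<And>B. B \<in> sets (F t) \<Longrightarrow> (\<integral>\<^sup>+\<omega>\<in>B. Zbar M F Y m \<delta> t \<omega> \<partial>M) =
        (SUP k. \<integral>\<^sup>+\<omega>\<in>B. reward m (\<lambda>i. T k (Suc i)) \<omega> \<partial>M)"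
    show "\<exists>T. ?P t T"
      by (intro exI[of _ T] conjI allI ballI T)
  qed
  then have "\<forall>t. \<exists>T. ?P t T" by (rule allI)
  from choice[OF this] obtain S where S: "\<forall>t. ?P t (S t)" ..
  define T where "T k = (\<lambda>i \<omega>. S (\<tau> \<omega>) k i \<omega>)" for k
  have S1: "S t k 1 = (\<lambda>_. t)" and S_strat: "S t k \<in> strategies M (Suc m) \<delta> F (\<lambda>_. t)" for t k
    using S by blast+
  have T1: "T k 1 = \<tau>" for k using S1 by (simp add: T_def)
  have T: "T k \<in> strategies M (Suc m) \<delta> F \<sigma>" for k
    unfolding T_def
  proof (rule strategies_paste[OF filtration_F R, where T="\<lambda>t. S t k" and c=\<tau>])
    fix t u :: ennreal
    have eq: "{\<omega>\<in>space M. \<tau> \<omega> = t} \<in> sets (F t)"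
      using stopping_time_eq_const[OF \<tau>(1), of t] by (simp add: pred_def space_F)
    show "{\<omega>\<in>space M. \<tau> \<omega> = t \<and> S t k 1 \<omega> \<le> u} \<in> sets (F u)"
    proof (cases "t \<le> u")
      case True
      then show ?thesis using eq sets_F_mono[OF True] by (auto simp: S1[unfolded One_nat_def])
    next
      case False
      then have "{\<omega>\<in>space M. \<tau> \<omega> = t \<and> S t k 1 \<omega> \<le> u} = {}" by (auto simp: S1[unfolded One_nat_def])
      then show ?thesis by (simp only: sets.empty_sets)
    qed
  qed (use S_strat S1 \<tau>(2) in auto)
  show thesis
  proof (rule that)
    show "T k \<in> strategies_disc M (Suc m) \<delta> F \<sigma>" for k
      using T R T1 by (simp add: strategies_disc_def)
    fix B assume B: "B \<in> sets (pre_sigma \<sigma>)"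
    let ?C = "\<lambda>t. B \<inter> {\<omega>\<in>space M. \<tau> \<omega> = t}"
    have C: "?C t \<in> sets (F t)" for t
      by (rule Int_eq_const_in_sets[OF \<sigma> \<tau> B])
    have [measurable]: "B \<in> sets M"
      using B subalgebra_pre_sigma[OF filtration_F sets_F_subset \<sigma>] by (auto simp: subalgebra_def)
    note [measurable] = measurable_at_stopping_time[OF \<tau>(1)]
    have meas: "reward m (\<lambda>i. T k (Suc i)) \<in> borel_measurable M" for k
      by (intro measurable_reward measurable_strategies[OF filtration_F sets_F_subset T measurable_\<delta>]) auto
    let ?g = "\<lambda>k t. \<integral>\<^sup>+\<omega>\<in>?C t. reward m (\<lambda>i. S t k (Suc i)) \<omega> \<partial>M"
    have "(\<integral>\<^sup>+\<omega>\<in>B. Zr (\<tau> \<omega>) \<omega> \<partial>M) = (\<integral>\<^sup>+t. (\<integral>\<^sup>+\<omega>\<in>?C t. Zr (\<tau> \<omega>) \<omega> \<partial>M) \<partial>count_space (\<tau> ` space M))"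
      by (rule set_nn_integral_partition[OF \<sigma> \<tau> R B]) measurable
    also have "\<dots> = (\<integral>\<^sup>+t. (\<integral>\<^sup>+\<omega>\<in>?C t. Zr t \<omega> \<partial>M) \<partial>count_space (\<tau> ` space M))"
      by (intro nn_integral_cong) (auto split: split_indicator)
    also have "\<dots> = (\<integral>\<^sup>+t. (SUP k. ?g k t) \<partial>count_space (\<tau> ` space M))"
      using S C by (simp add: set_nn_integral_Zr)
    \<comment> \<open>Monotone convergence for the counting measure; \<open>?g\<close> increases in
      \<open>k\<close> by the choice of the tails.\<close>
    also have "\<dots> = (SUP k. \<integral>\<^sup>+t. ?g k t \<partial>count_space (\<tau> ` space M))"
    proof (rule nn_integral_monotone_convergence_SUP)
      show "incseq ?g"
        using S C unfolding incseq_def le_fun_def by blast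
    qed simp
    also have "\<dots> = (SUP k. \<integral>\<^sup>+\<omega>\<in>B. reward m (\<lambda>i. T k (Suc i)) \<omega> \<partial>M)"
    proof (rule SUP_cong[OF refl])
      fix k
      have "(\<integral>\<^sup>+\<omega>\<in>B. reward m (\<lambda>i. T k (Suc i)) \<omega> \<partial>M) =
          (\<integral>\<^sup>+t. (\<integral>\<^sup>+\<omega>\<in>?C t. reward m (\<lambda>i. T k (Suc i)) \<omega> \<partial>M) \<partial>count_space (\<tau> ` space M))"
        by (rule set_nn_integral_partition[OF \<sigma> \<tau> R B meas])
      also have "\<dots> = (\<integral>\<^sup>+t. ?g k t \<partial>count_space (\<tau> ` space M))"
        by (intro nn_integral_cong) (auto simp: T_def split: split_indicator)
      finally show "(\<integral>\<^sup>+t. ?g k t \<partial>count_space (\<tau> ` space M)) =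
          (\<integral>\<^sup>+\<omega>\<in>B. reward m (\<lambda>i. T k (Suc i)) \<omega> \<partial>M)" ..
    qed
    finally have "(\<integral>\<^sup>+\<omega>\<in>B. Y (\<tau> \<omega>) \<omega> \<partial>M) + (\<integral>\<^sup>+\<omega>\<in>B. Zr (\<tau> \<omega>) \<omega> \<partial>M) =
        (SUP k. (\<integral>\<^sup>+\<omega>\<in>B. Y (\<tau> \<omega>) \<omega> \<partial>M) + (\<integral>\<^sup>+\<omega>\<in>B. reward m (\<lambda>i. T k (Suc i)) \<omega> \<partial>M))"
      by (simp add: ennreal_SUP_add_right)
    also have "\<dots> = (SUP k. \<integral>\<^sup>+\<omega>\<in>B. reward (Suc m) (T k) \<omega> \<partial>M)"
      unfolding reward_Suc T1
      by (intro SUP_cong refl nn_set_integral_add[symmetric] meas) measurable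
    also have "(\<integral>\<^sup>+\<omega>\<in>B. Y (\<tau> \<omega>) \<omega> \<partial>M) + (\<integral>\<^sup>+\<omega>\<in>B. Zr (\<tau> \<omega>) \<omega> \<partial>M) =
        (\<integral>\<^sup>+\<omega>\<in>B. Y (\<tau> \<omega>) \<omega> + Zr (\<tau> \<omega>) \<omega> \<partial>M)"
      by (intro nn_set_integral_add[symmetric]) measurable
    finally show "(\<integral>\<^sup>+\<omega>\<in>B. Y (\<tau> \<omega>) \<omega> + Zr (\<tau> \<omega>) \<omega> \<partial>M) \<le> (SUP k. \<integral>\<^sup>+\<omega>\<in>B. reward (Suc m) (T k) \<omega> \<partial>M)"
      by simp
  qed
qed

abbreviation cond_stop_value :: "('a \<Rightarrow> ennreal) \<Rightarrow> ('a \<Rightarrow> ennreal) \<Rightarrow> 'a \<Rightarrow> ennreal" where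
  "cond_stop_value \<sigma> \<tau> \<equiv> nn_cond_exp M (pre_sigma \<sigma>) (\<lambda>\<omega>. Y (\<tau> \<omega>) \<omega> + Zr (\<tau> \<omega>) \<omega>)"

lemma sigma_finite_subalgebra_pre_sigma:
  "stopping_time F \<sigma> \<Longrightarrow> sigma_finite_subalgebra M (pre_sigma \<sigma>)"
  by (rule sigma_finite_subalgebraI[OF subalgebra_pre_sigma[OF filtration_F sets_F_subset]])

lemma measurable_strategy_reward:
  assumes "T \<in> strategies M (Suc m) \<delta> F \<sigma>"
  shows "reward (Suc m) T \<in> borel_measurable M"
  by (intro measurable_reward measurable_strategies[OF filtration_F sets_F_subset assms measurable_\<delta>]) auto

lemma cond_reward_le_cond_stop_value:
  assumes \<sigma>: "stopping_time F \<sigma>" and T: "T \<in> strategies_disc M (Suc m) \<delta> F \<sigma>"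
  shows "AE \<omega> in M. cond_reward F \<sigma> (Suc m) T \<omega> \<le> cond_stop_value \<sigma> (T 1) \<omega>"
proof -
  interpret G: sigma_finite_subalgebra M "pre_sigma \<sigma>"
    by (rule sigma_finite_subalgebra_pre_sigma[OF \<sigma>])
  have S: "T \<in> strategies M (Suc m) \<delta> F \<sigma>" using T by (simp add: strategies_disc_def)
  have T1: "stopping_time F (T 1)" using strategiesD(1)[OF S, of 1] by simp
  note [measurable] = measurable_at_stopping_time[OF T1]
  \<comment> \<open>A constant sequence suffices to turn the inequality of set integrals into one of
    conditional expectations.\<close>
  have "AE \<omega> in M. cond_reward F \<sigma> (Suc m) T \<omega> \<le> (SUP k::nat. cond_stop_value \<sigma> (T 1) \<omega>)"
  proof (rule G.nn_cond_exp_le_SUP)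
    show "reward (Suc m) T \<in> borel_measurable M" by (rule measurable_strategy_reward[OF S])
    fix B assume "B \<in> sets (pre_sigma \<sigma>)"
    then show "(\<integral>\<^sup>+\<omega>\<in>B. reward (Suc m) T \<omega> \<partial>M) \<le> (SUP k::nat. \<integral>\<^sup>+\<omega>\<in>B. Y (T 1 \<omega>) \<omega> + Zr (T 1 \<omega>) \<omega> \<partial>M)"
      using set_nn_integral_reward_le[OF \<sigma> T] by simp
  qed measurable
  then show ?thesis by simp
qed

text \<open>Rounded-up times are discrete and stay above \<open>\<sigma>\<close>, so a single bound
  \<open>W\<close> serves all of them and passes to the limit.\<close>

lemma cond_stop_value_le:
  assumes \<sigma>: "stopping_time F \<sigma>" and \<tau>: "stopping_time F \<tau>" "\<And>\<omega>. \<omega> \<in> space M \<Longrightarrow> \<sigma> \<omega> \<le> \<tau> \<omega>"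
    and W: "\<And>T. T \<in> strategies_disc M (Suc m) \<delta> F \<sigma> \<Longrightarrow> AE \<omega> in M. cond_reward F \<sigma> (Suc m) T \<omega> \<le> W \<omega>"
  shows "AE \<omega> in M. cond_stop_value \<sigma> \<tau> \<omega> \<le> W \<omega>"
proof -
  interpret G: sigma_finite_subalgebra M "pre_sigma \<sigma>"
    by (rule sigma_finite_subalgebra_pre_sigma[OF \<sigma>])
  have countable_case: "AE \<omega> in M. cond_stop_value \<sigma> \<rho> \<omega> \<le> W \<omega>"
    if \<rho>: "stopping_time F \<rho>" "\<And>\<omega>. \<omega> \<in> space M \<Longrightarrow> \<sigma> \<omega> \<le> \<rho> \<omega>" and R: "countable (\<rho> ` space M)" for \<rho>
  proof (rule ex_strategies_disc_approx[OF \<sigma> \<rho> R])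
    fix T :: "nat \<Rightarrow> nat \<Rightarrow> 'a \<Rightarrow> ennreal"
    assume T: "\<And>k. T k \<in> strategies_disc M (Suc m) \<delta> F \<sigma>"
      "\<And>B. B \<in> sets (pre_sigma \<sigma>) \<Longrightarrow> (\<integral>\<^sup>+\<omega>\<in>B. Y (\<rho> \<omega>) \<omega> + Zr (\<rho> \<omega>) \<omega> \<partial>M) \<le>
        (SUP k. \<integral>\<^sup>+\<omega>\<in>B. reward (Suc m) (T k) \<omega> \<partial>M)"
    have meas: "reward (Suc m) (T k) \<in> borel_measurable M" for k
      using T(1)[of k] by (intro measurable_strategy_reward) (auto simp: strategies_disc_def)
    note [measurable] = measurable_at_stopping_time[OF \<rho>(1)]
    have "AE \<omega> in M. cond_stop_value \<sigma> \<rho> \<omega> \<le> (SUP k. cond_reward F \<sigma> (Suc m) (T k) \<omega>)"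
      by (rule G.nn_cond_exp_le_SUP[OF _ meas T(2)]) measurable
    moreover have "AE \<omega> in M. \<forall>k. cond_reward F \<sigma> (Suc m) (T k) \<omega> \<le> W \<omega>"
      using W[OF T(1)] by (simp add: AE_all_countable)
    ultimately show ?thesis
      by eventually_elim (meson SUP_least order_trans)
  qed
  let ?\<tau> = "\<lambda>k \<omega>. round_up k (\<tau> \<omega>)"
  have st: "stopping_time F (?\<tau> k)" for k
    by (rule stopping_time_compose[OF \<tau>(1) measurable_round_up le_round_up])
  show ?thesis
  proof (rule G.nn_cond_exp_le_of_LIMSEQ)
    show "(\<lambda>\<omega>. Y (\<tau> \<omega>) \<omega> + Zr (\<tau> \<omega>) \<omega>) \<in> borel_measurable M"
      by (intro borel_measurable_add measurable_at_stopping_time \<tau>)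
    show "(\<lambda>\<omega>. Y (?\<tau> k \<omega>) \<omega> + Zr (?\<tau> k \<omega>) \<omega>) \<in> borel_measurable M" for k
      by (intro borel_measurable_add measurable_at_stopping_time(2,3)[OF st])
    show "(\<lambda>k. Y (?\<tau> k \<omega>) \<omega> + Zr (?\<tau> k \<omega>) \<omega>) \<longlonglongrightarrow> Y (\<tau> \<omega>) \<omega> + Zr (\<tau> \<omega>) \<omega>" if "\<omega> \<in> space M" for \<omega>
      by (rule tendsto_add[OF right_continuous_paths_LIMSEQ[OF right_continuous_Y that LIMSEQ_round_up le_round_up]
        right_continuous_paths_LIMSEQ[OF right_continuous_Zr that LIMSEQ_round_up le_round_up]])
    show "AE \<omega> in M. cond_stop_value \<sigma> (?\<tau> k) \<omega> \<le> W \<omega>" for k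
    proof (rule countable_case[OF st])
      show "\<sigma> \<omega> \<le> ?\<tau> k \<omega>" if "\<omega> \<in> space M" for \<omega>
        using \<tau>(2)[OF that] le_round_up[of "\<tau> \<omega>" k] by (rule order_trans)
      show "countable (?\<tau> k ` space M)"
        by (rule countable_subset[OF _ countable_range_round_up[of k]]) auto
    qed
  qed
qed

lemma is_family_esssup_cond_stop_value:
  "is_family_esssup M (cond_stop_value \<sigma> ` S) (family_esssup M (cond_stop_value \<sigma> ` S))"
  by (intro is_family_esssup_family_esssup) auto

lemma is_family_esssup_Zval:
  "is_family_esssup M (cond_reward F \<sigma> (Suc m) ` strategies M (Suc m) \<delta> F \<sigma>) (Zval M Y (Suc m) \<delta> F \<sigma>)"
  "is_family_esssup M (cond_reward F \<sigma> (Suc m) ` strategies_disc M (Suc m) \<delta> F \<sigma>)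
    (Zval_disc M Y (Suc m) \<delta> F \<sigma>)"
  by (simp_all only: Zval_def Zval_disc_def Suc_not_Zero if_False is_family_esssup_value_over)

lemma cond_reward_le_Zval_disc:
  "T \<in> strategies_disc M (Suc m) \<delta> F \<sigma> \<Longrightarrow>
    AE \<omega> in M. cond_reward F \<sigma> (Suc m) T \<omega> \<le> Zval_disc M Y (Suc m) \<delta> F \<sigma> \<omega>"
  using is_family_esssup_Zval(2)[of \<sigma>] unfolding is_family_esssup_def by blast

lemma Zval_disc_eq:
  assumes \<sigma>: "stopping_time F \<sigma>"
  shows "AE \<omega> in M. Zval_disc M Y (Suc m) \<delta> F \<sigma> \<omega> =
    family_esssup M (cond_stop_value \<sigma> ` stopping_times_from M F \<sigma>) \<omega>" (is "AE \<omega> in M. _ = ?E \<omega>")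
proof -
  note E = is_family_esssup_cond_stop_value[of \<sigma> "stopping_times_from M F \<sigma>"]
  have "AE \<omega> in M. Zval_disc M Y (Suc m) \<delta> F \<sigma> \<omega> \<le> ?E \<omega>"
  proof (rule is_family_esssup_le[OF is_family_esssup_Zval(2) E])
    fix X assume "X \<in> cond_reward F \<sigma> (Suc m) ` strategies_disc M (Suc m) \<delta> F \<sigma>"
    then obtain T where T: "T \<in> strategies_disc M (Suc m) \<delta> F \<sigma>" and X: "X = cond_reward F \<sigma> (Suc m) T"
      by blast
    then have "T 1 \<in> stopping_times_from M F \<sigma>"
      by (simp add: strategies_disc_def strategies_def)
    then have "AE \<omega> in M. cond_stop_value \<sigma> (T 1) \<omega> \<le> ?E \<omega>"
      using E unfolding is_family_esssup_def by blast
    with cond_reward_le_cond_stop_value[OF \<sigma> T] show "AE \<omega> in M. X \<omega> \<le> ?E \<omega>"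
      unfolding X by eventually_elim (rule order_trans)
  qed
  moreover have "AE \<omega> in M. ?E \<omega> \<le> Zval_disc M Y (Suc m) \<delta> F \<sigma> \<omega>"
  proof (rule is_family_esssup_le[OF E is_family_esssup_Zval(2)])
    fix X assume "X \<in> cond_stop_value \<sigma> ` stopping_times_from M F \<sigma>"
    then obtain \<tau> where "stopping_time F \<tau>" "\<And>\<omega>. \<omega> \<in> space M \<Longrightarrow> \<sigma> \<omega> \<le> \<tau> \<omega>" and X: "X = cond_stop_value \<sigma> \<tau>"
      by (auto simp: stopping_times_from_def)
    then show "AE \<omega> in M. X \<omega> \<le> Zval_disc M Y (Suc m) \<delta> F \<sigma> \<omega>"
      unfolding X by (intro cond_stop_value_le[OF \<sigma>] cond_reward_le_Zval_disc)
  qed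
  ultimately show ?thesis by eventually_elim (rule antisym)
qed

end

subsection \<open>Waiting times that are stopping times\<close>

text \<open>\<open>S\<close> and \<open>T\<close> need not be known at time \<open>t\<close>, but
  their truncations at \<open>t\<close> are. If the sum is at most \<open>t\<close>, so are both
  summands, hence truncation does not alter the event.\<close>

lemma stopping_time_add:
  fixes A :: "ennreal \<Rightarrow> 'a measure" and S T :: "'a \<Rightarrow> ennreal"
  assumes A: "filtration (space M) A" and S: "stopping_time A S" and T: "stopping_time A T"
  shows "stopping_time A (\<lambda>\<omega>. S \<omega> + T \<omega>)"
proof
  fix t
  have min: "(\<lambda>\<omega>. min (R \<omega>) t) \<in> borel_measurable (A t)" if R: "stopping_time A R" for R :: "'a \<Rightarrow> ennreal"
  proof (rule borel_measurableI_le)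
    fix s
    show "{\<omega>\<in>space (A t). min (R \<omega>) t \<le> s} \<in> sets (A t)"
    proof (cases "t \<le> s")
      case True
      then have "{\<omega>\<in>space (A t). min (R \<omega>) t \<le> s} = space (A t)" by (auto simp: min_le_iff_disj)
      then show ?thesis by simp
    next
      case False
      then have "{\<omega>\<in>space (A t). min (R \<omega>) t \<le> s} = {\<omega>\<in>space (A t). R \<omega> \<le> s}" by (auto simp: min_le_iff_disj)
      then show ?thesis
        using filtration.stopping_time_le_const[OF A R, of s t] False by (simp add: pred_def)
    qed
  qed
  note [measurable] = min[OF S] min[OF T] stopping_timeD[OF S, of t] stopping_timeD[OF T, of t]
  have "Measurable.pred (A t) (\<lambda>\<omega>. S \<omega> \<le> t \<and> T \<omega> \<le> t \<and> min (S \<omega>) t + min (T \<omega>) t \<le> t)"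
    by measurable
  moreover have "S \<omega> \<le> t \<and> T \<omega> \<le> t \<and> min (S \<omega>) t + min (T \<omega>) t \<le> t \<longleftrightarrow> S \<omega> + T \<omega> \<le> t" for \<omega>
    by (metis (no_types, opaque_lifting) add_increasing add_increasing2 le_iff_add min.absorb1
        order_trans order_refl zero_le add.commute)
  ultimately show "Measurable.pred (A t) (\<lambda>\<omega>. S \<omega> + T \<omega> \<le> t)" by simp
qed

lemma enlarge_cong_sets:
  assumes "\<And>t. sets (A t) = sets (A' t)"
  shows "enlarge M A \<rho> = enlarge M A' \<rho>"
  by (simp add: fun_eq_iff enlarge_def adjoin_time_def assms)

lemma stopping_time_cong_sets:
  fixes A A' :: "ennreal \<Rightarrow> 'a measure" and T :: "'a \<Rightarrow> ennreal"
  assumes "filtration (space M) A" "filtration (space M) A'" "\<And>t. sets (A t) = sets (A' t)"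
  shows "stopping_time A T \<longleftrightarrow> stopping_time A' T"
  by (simp add: stopping_time_iff_sets[OF assms(1)] stopping_time_iff_sets[OF assms(2)] assms(3))

context usual_filtration
begin

text \<open>Adjoining \<open>\<rho>\<close> adds no event at any time. Right-continuity of
  \<open>F\<close> then absorbs the intersection at finite times, and at \<infinity> the generation
  of \<open>F \<infinity>\<close> by finite times does.\<close>

lemma sets_enlarge_stopping_time:
  assumes \<rho>: "stopping_time F \<rho>"
  shows "sets (enlarge M F \<rho> t) = sets (F t)"
proof -
  have F: "filtration (space M) F" by unfold_locales
  have adj: "sets (adjoin_time M F \<rho> s) = sets (F s)" for s
  proof (rule antisym)
    show "sets (adjoin_time M F \<rho> s) \<subseteq> sets (F s)"
    proof (rule sets_adjoin_time_subset[OF F])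
      show "{\<omega>\<in>space M. \<rho> \<omega> \<le> r} \<in> sets (F s)" if "r \<le> s" for r
        using stopping_time_le_const[OF \<rho> that] by (simp add: pred_def space_F)
    qed (auto simp: space_F)
  qed (rule sets_subset_adjoin_time[OF F])
  show ?thesis
  proof (cases "t < \<infinity>")
    case True
    then show ?thesis by (simp add: sets_enlarge[OF F] adj right_continuous_F)
  next
    case False
    then have "t = \<top>" by (simp add: not_less top_unique)
    then show ?thesis using sets_F_infinity by (simp add: sets_enlarge_top adj)
  qed
qed

lemma sets_enlarge_seq_stopping_times:
  assumes "\<And>j. j \<in> {1..i} \<Longrightarrow> stopping_time F (\<rho> j)"
  shows "sets (enlarge_seq M F \<rho> i t) = sets (F t)"
  using assms
proof (induction i arbitrary: t)
  case (Suc i)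
  then have "enlarge M (enlarge_seq M F \<rho> i) (\<rho> (Suc i)) = enlarge M F (\<rho> (Suc i))"
    by (intro enlarge_cong_sets) auto
  then show ?case
    using Suc.prems sets_enlarge_stopping_time by simp
qed simp

lemma stopping_time_enlarge_seq_iff:
  assumes "\<And>j. j \<in> {1..i} \<Longrightarrow> stopping_time F (\<rho> j)"
  shows "stopping_time (enlarge_seq M F \<rho> i) T \<longleftrightarrow> stopping_time F T"
proof -
  have F: "filtration (space M) F" by unfold_locales
  show ?thesis
    by (rule stopping_time_cong_sets[OF filtration_enlarge_seq[OF F] F sets_enlarge_seq_stopping_times[OF assms]])
qed

lemma strategies_stopping_times:
  assumes \<gamma>: "\<And>i. i \<in> {1..<n} \<Longrightarrow> stopping_time F (\<gamma> i)"
    and T: "T \<in> strategies M n \<gamma> F \<sigma>" and i: "i \<in> {1..max 1 n}"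
  shows "stopping_time F (T i)"
  using i
proof (induction i rule: less_induct)
  case (less i)
  have F: "filtration (space M) F" by unfold_locales
  have "stopping_time F (\<lambda>\<omega>. T j \<omega> + \<gamma> j \<omega>)" if "j \<in> {1..i - 1}" for j
    using that less.prems by (intro stopping_time_add[OF F] less.IH \<gamma>) auto
  from stopping_time_enlarge_seq_iff[of "i - 1" "\<lambda>j \<omega>. T j \<omega> + \<gamma> j \<omega>", OF this] strategiesD(1)[OF T less.prems]
  show ?case by blast
qed

text \<open>As all enlargements coincide with \<open>F\<close>, admissibility of stopping times
  reduces to the order constraints; this permits later times to be postponed.\<close>

lemma strategies_stopping_timesI:
  assumes \<gamma>: "\<And>i. i \<in> {1..<n} \<Longrightarrow> stopping_time F (\<gamma> i)"
    and T: "\<And>i. i \<in> {1..max 1 n} \<Longrightarrow> stopping_time F (T i)"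
    and "\<And>\<omega>. \<omega> \<in> space M \<Longrightarrow> \<sigma> \<omega> \<le> T 1 \<omega>"
    and "\<And>i \<omega>. i \<in> {1..<n} \<Longrightarrow> \<omega> \<in> space M \<Longrightarrow> T i \<omega> + \<gamma> i \<omega> \<le> T (Suc i) \<omega>"
  shows "T \<in> strategies M n \<gamma> F \<sigma>"
proof (rule strategiesI)
  have F: "filtration (space M) F" by unfold_locales
  fix i assume i: "i \<in> {1..max 1 n}"
  have "stopping_time F (\<lambda>\<omega>. T j \<omega> + \<gamma> j \<omega>)" if "j \<in> {1..i - 1}" for j
    using that i by (intro stopping_time_add[OF F] T \<gamma>) auto
  from stopping_time_enlarge_seq_iff[of "i - 1" "\<lambda>j \<omega>. T j \<omega> + \<gamma> j \<omega>", OF this] T[OF i]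
  show "stopping_time (enlarge_seq M F (\<lambda>j \<omega>. T j \<omega> + \<gamma> j \<omega>) (i - 1)) (T i)" by blast
qed (use assms(3,4) in auto)

end

text \<open>\<open>delay \<delta> T k j\<close> stands for the exercise time with number \<open>j + 1\<close>: the first time is rounded up,
  and every later time is postponed as little as the waiting times require.\<close>

primrec delay ::
  "(nat \<Rightarrow> 'a \<Rightarrow> ennreal) \<Rightarrow> (nat \<Rightarrow> 'a \<Rightarrow> ennreal) \<Rightarrow> nat \<Rightarrow> nat \<Rightarrow> 'a \<Rightarrow> ennreal" where
  "delay \<delta> T k 0 = (\<lambda>\<omega>. round_up k (T 1 \<omega>))"
| "delay \<delta> T k (Suc j) = (\<lambda>\<omega>. max (T (Suc (Suc j)) \<omega>) (delay \<delta> T k j \<omega> + \<delta> (Suc j) \<omega>))"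

lemma le_delay: "T (Suc j) \<omega> \<le> delay \<delta> T k j \<omega>"
  by (cases j) (auto simp: le_round_up)

text \<open>The constraint between consecutive times makes the maximum collapse to the original time
  in the limit, so the postponement disappears as the grid is refined.\<close>

lemma LIMSEQ_delay:
  assumes "\<And>i. i \<in> {1..j} \<Longrightarrow> T i \<omega> + \<delta> i \<omega> \<le> T (Suc i) \<omega>"
  shows "(\<lambda>k. delay \<delta> T k j \<omega>) \<longlonglongrightarrow> T (Suc j) \<omega>"
  using assms
proof (induction j)
  case 0
  show ?case by (simp add: LIMSEQ_round_up)
next
  case (Suc j)
  have "(\<lambda>k. delay \<delta> T k j \<omega>) \<longlonglongrightarrow> T (Suc j) \<omega>" by (rule Suc.IH) (use Suc.prems in auto)
  then have "(\<lambda>k. max (T (Suc (Suc j)) \<omega>) (delay \<delta> T k j \<omega> + \<delta> (Suc j) \<omega>))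
      \<longlonglongrightarrow> max (T (Suc (Suc j)) \<omega>) (T (Suc j) \<omega> + \<delta> (Suc j) \<omega>)"
    by (intro tendsto_max tendsto_add tendsto_const)
  then show ?case using Suc.prems[of "Suc j"] by (simp add: max_absorb1)
qed

section \<open>Arbitrary first exercise times, and adaptedness of the modification\<close>

context continuation_process
begin

lemma Zval_eq_Zval_disc:
  assumes \<sigma>: "stopping_time F \<sigma>" and \<delta>: "\<And>i. i \<in> {1..m} \<Longrightarrow> stopping_time F (\<delta> i)"
  shows "AE \<omega> in M. Zval M Y (Suc m) \<delta> F \<sigma> \<omega> = Zval_disc M Y (Suc m) \<delta> F \<sigma> \<omega>"
proof -
  have "AE \<omega> in M. Zval M Y (Suc m) \<delta> F \<sigma> \<omega> \<le> Zval_disc M Y (Suc m) \<delta> F \<sigma> \<omega>"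
  proof (rule is_family_esssup_le[OF is_family_esssup_Zval])
    fix X assume "X \<in> cond_reward F \<sigma> (Suc m) ` strategies M (Suc m) \<delta> F \<sigma>"
    then obtain T where T: "T \<in> strategies M (Suc m) \<delta> F \<sigma>" and X: "X = cond_reward F \<sigma> (Suc m) T"
      by blast
    interpret G: sigma_finite_subalgebra M "pre_sigma \<sigma>"
      by (rule sigma_finite_subalgebra_pre_sigma[OF \<sigma>])
    define S where "S k = (\<lambda>i. delay \<delta> T k (i - 1))" for k
    have st: "stopping_time F (T i)" if "i \<in> {1..Suc m}" for i
      using that \<delta> by (intro strategies_stopping_times[OF _ T]) auto
    have delay_st: "stopping_time F (delay \<delta> T k j)" if "j \<le> m" for j k
      using that
    proof (induction j)
      case 0
      then show ?case
        using st[of 1] by (auto intro!: stopping_time_compose[OF _ measurable_round_up le_round_up])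
    next
      case (Suc j)
      then show ?case
        unfolding delay.simps by (intro stopping_time_max stopping_time_add[OF filtration_F] \<delta> st) auto
    qed
    have S_st: "stopping_time F (S k i)" if "i \<in> {1..Suc m}" for k i
      using delay_st[of "i - 1" k] that by (auto simp: S_def)
    have S: "S k \<in> strategies M (Suc m) \<delta> F \<sigma>" for k
    proof (rule strategies_stopping_timesI)
      show "\<sigma> \<omega> \<le> S k 1 \<omega>" if "\<omega> \<in> space M" for \<omega>
        using strategiesD(2)[OF T that] le_delay[of T 0 \<omega> \<delta> k] by (simp add: S_def)
      show "S k i \<omega> + \<delta> i \<omega> \<le> S k (Suc i) \<omega>" if "i \<in> {1..<Suc m}" "\<omega> \<in> space M" for i \<omega>
        using that by (cases i) (auto simp: S_def)
    qed (use S_st \<delta> in auto)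
    have "countable (S k 1 ` space M)" for k
      by (rule countable_subset[OF _ countable_range_round_up[of k]]) (auto simp: S_def)
    with S have S_disc: "S k \<in> strategies_disc M (Suc m) \<delta> F \<sigma>" for k
      by (simp add: strategies_disc_def)
    show "AE \<omega> in M. X \<omega> \<le> Zval_disc M Y (Suc m) \<delta> F \<sigma> \<omega>"
      unfolding X
    proof (rule G.nn_cond_exp_le_of_LIMSEQ[OF measurable_strategy_reward[OF T]
          measurable_strategy_reward[OF S] _ cond_reward_le_Zval_disc[OF S_disc]])
      fix \<omega> assume \<omega>: "\<omega> \<in> space M"
      show "(\<lambda>k. reward (Suc m) (S k) \<omega>) \<longlonglongrightarrow> reward (Suc m) T \<omega>"
      proof (rule tendsto_sum)
        fix i assume i: "i \<in> {1..Suc m}"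
        have "(\<lambda>k. delay \<delta> T k (i - 1) \<omega>) \<longlonglongrightarrow> T (Suc (i - 1)) \<omega>"
          using strategiesD(3)[OF T _ \<omega>] i by (intro LIMSEQ_delay) auto
        then have lim: "(\<lambda>k. S k i \<omega>) \<longlonglongrightarrow> T i \<omega>" using i by (simp add: S_def)
        have "T i \<omega> \<le> S k i \<omega>" for k
          using le_delay[of T "i - 1" \<omega> \<delta> k] i by (simp add: S_def)
        with lim show "(\<lambda>k. Y (S k i \<omega>) \<omega>) \<longlonglongrightarrow> Y (T i \<omega>) \<omega>"
          by (rule right_continuous_paths_LIMSEQ[OF right_continuous_Y \<omega>])
      qed
    qed
  qed
  moreover have "AE \<omega> in M. Zval_disc M Y (Suc m) \<delta> F \<sigma> \<omega> \<le> Zval M Y (Suc m) \<delta> F \<sigma> \<omega>"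
    using is_family_esssup_Zval(1)[of \<sigma>]
    by (intro is_family_esssup_le[OF is_family_esssup_Zval(2,1)])
       (auto simp: is_family_esssup_def strategies_disc_def)
  ultimately show ?thesis by eventually_elim (rule antisym)
qed

text \<open>A modification is only required to be \<open>M\<close>-measurable. It agrees almost
  surely with the \<open>F t\<close>-measurable \<open>Zbar\<close>, and every null set lies in
  \<open>F 0\<close>, so each preimage under \<open>Zr t\<close> is one under \<open>Zbar\<close>
  corrected by sets of \<open>F t\<close>.\<close>

lemma adapted_Zr: "adapted F Zr"
  unfolding adapted_def
proof (intro allI impI)
  fix t :: ennreal
  let ?Z = "Zbar M F Y m \<delta> t"
  have Z: "?Z \<in> borel_measurable (F t)" by (simp add: Zbar_def)
  have null: "N \<in> sets (F t)" if "N \<in> null_sets M" for N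
    using null_sets_F sets_F_mono[of 0 t] that by auto
  show "Zr t \<in> borel_measurable (F t)"
  proof (rule measurableI)
    fix B :: "ennreal set" assume B: "B \<in> sets borel"
    let ?P = "Zr t -` B \<inter> space M" and ?Q = "?Z -` B \<inter> space M"
    have Q: "?Q \<in> sets (F t)" using measurable_sets[OF Z B] by (simp add: space_F)
    then have QM: "?Q \<in> sets M" using sets_F_subset by blast
    have PM: "?P \<in> sets M" using measurable_sets[OF measurable_Zr B] .
    have "AE \<omega> in M. \<omega> \<notin> ?P - ?Q" "AE \<omega> in M. \<omega> \<notin> ?Q - ?P"
      using AE_Zr[of t] by auto
    then have "?P - ?Q \<in> sets (F t)" "?Q - ?P \<in> sets (F t)"
      using AE_iff_null_sets[of "?P - ?Q" M] AE_iff_null_sets[of "?Q - ?P" M] PM QM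
      by (blast intro: null)+
    then have "(?Q - (?Q - ?P)) \<union> (?P - ?Q) \<in> sets (F t)" using Q by blast
    also have "(?Q - (?Q - ?P)) \<union> (?P - ?Q) = ?P" by auto
    finally show "Zr t -` B \<inter> space (F t) \<in> sets (F t)" by (simp add: space_F)
  qed simp
qed

end

theorem theorem3p5:
  fixes M :: "'a measure" and F :: "ennreal \<Rightarrow> 'a measure"
    and Y Zr Yn :: "ennreal \<Rightarrow> 'a \<Rightarrow> ennreal"
    and \<delta> :: "nat \<Rightarrow> 'a \<Rightarrow> ennreal" and n :: nat
  assumes "usual_filtration M F"
    and "adapted F Y"
    and "\<And>t \<omega>. t < \<infinity> \<Longrightarrow> \<omega> \<in> space M \<Longrightarrow> Y t \<omega> < \<infinity>"
    and "right_continuous_paths M Y"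
    and "(\<integral>\<^sup>+\<omega>. (SUP t\<in>{..<\<infinity>}. Y t \<omega>) \<partial>M) < \<infinity>"
    and "\<And>\<omega>. \<omega> \<in> space M \<Longrightarrow> Y \<infinity> \<omega> = Limsup at_top (\<lambda>t::real. Y (ennreal t) \<omega>)"
    and "n \<ge> 1"
    and "\<And>i. i \<in> {1..<n} \<Longrightarrow> \<delta> i \<in> borel_measurable M"
    and "\<And>i. i \<in> {1..<n} \<Longrightarrow> AE \<omega> in M. \<delta> i \<omega> < \<infinity>"
    and "right_continuous_modification M (Zbar M F Y (n - 1) \<delta>) Zr"
    and "Yn = (\<lambda>t \<omega>. Y t \<omega> + Zr t \<omega>)"
  shows "adapted F Yn \<and> right_continuous_paths M Yn \<and>
    (\<forall>\<sigma>. stopping_time F \<sigma> \<longrightarrow>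
      (AE \<omega> in M. Zval_disc M Y n \<delta> F \<sigma> \<omega> =
        family_esssup M
          ((\<lambda>\<tau>. nn_cond_exp M (filtration.pre_sigma (space M) F \<sigma>) (\<lambda>\<omega>'. Yn (\<tau> \<omega>') \<omega>'))
            ` stopping_times_from M F \<sigma>) \<omega>)) \<and>
    ((\<forall>i\<in>{1..<n}. stopping_time F (\<delta> i)) \<longrightarrow>
      (\<forall>\<sigma>. stopping_time F \<sigma> \<longrightarrow>
        (AE \<omega> in M. Zval M Y n \<delta> F \<sigma> \<omega> =
          family_esssup M
            ((\<lambda>\<tau>. nn_cond_exp M (filtration.pre_sigma (space M) F \<sigma>) (\<lambda>\<omega>'. Yn (\<tau> \<omega>') \<omega>'))
              ` stopping_times_from M F \<sigma>) \<omega>)))"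
proof -
  \<comment> \<open>The locale counts the exercises left after the first one, so \<open>m\<close> is
    \<open>n - 1\<close>.\<close>
  obtain m where n: "n = Suc m" using \<open>n \<ge> 1\<close> by (cases n) auto
  interpret F: usual_filtration M F by fact
  have Y_fin: "Y t \<in> borel_measurable M" if "t < \<infinity>" for t
    using that assms(2) measurable_from_subalg[OF F.subalgebra_F, of "Y t" t borel]
    by (auto simp: adapted_def)
  \<comment> \<open>Adaptedness covers finite times only; at \<infinity> measurability comes from
    the countable formula for the limit superior.\<close>
  have "Y \<infinity> \<in> borel_measurable M"
    using borel_measurable_Limsup_at_top[OF Y_fin assms(4)] assms(6) by (subst measurable_cong) auto
  then have Y: "Y t \<in> borel_measurable M" for t
    using Y_fin[of t] by (cases "t < \<infinity>") (auto simp: not_less top_unique)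
  interpret continuation_process M F Y m \<delta> Zr
    using Y assms(4,8,10) n by unfold_locales auto
  have "adapted F Yn"
    using assms(2) adapted_Zr by (auto simp: adapted_def assms(11) intro!: borel_measurable_add)
  moreover have "right_continuous_paths M Yn"
    using assms(4) right_continuous_Zr
    by (auto simp: right_continuous_paths_def assms(11) continuous_within intro!: tendsto_add)
  moreover have disc: "AE \<omega> in M. Zval_disc M Y n \<delta> F \<sigma> \<omega> =
      family_esssup M (cond_stop_value \<sigma> ` stopping_times_from M F \<sigma>) \<omega>" if "stopping_time F \<sigma>" for \<sigma>
    unfolding n by (rule Zval_disc_eq[OF that])
  moreover have "AE \<omega> in M. Zval M Y n \<delta> F \<sigma> \<omega> =
      family_esssup M (cond_stop_value \<sigma> ` stopping_times_from M F \<sigma>) \<omega>"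
    if \<delta>: "\<forall>i\<in>{1..<n}. stopping_time F (\<delta> i)" and \<sigma>: "stopping_time F \<sigma>" for \<sigma>
  proof -
    have "AE \<omega> in M. Zval M Y n \<delta> F \<sigma> \<omega> = Zval_disc M Y n \<delta> F \<sigma> \<omega>"
      unfolding n by (rule Zval_eq_Zval_disc[OF \<sigma>]) (use \<delta> n in auto)
    with disc[OF \<sigma>] show ?thesis by eventually_elim simp
  qed
  ultimately show ?thesis unfolding assms(11) by blast
qed


end
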